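(* For every integer $m\geq1$, $$\operatorname{rank}\bigl(\mathcal U_{\mathrm{core}}(S_4^m)\bigr)\geq m,$$ where $S_4^m$ is the direct product of $m$ copies of the symmetric group $S_4$. Hence the rank of $\mathcal U_{\mathrm{core}}(G)$ is unbounded as $G$ ranges over finite groups.
   Context: For a finite group $G$, $\Omega(G)$ is the Burnside ring (Grothendieck ring of finite $G$-sets), with $\mathbb Z$-basis $[G/H]$, $(H)$ running over the conjugacy classes of subgroups of $G$, and $1_{\Omega(G)}=[G/G]$. Its unit group is a finite elementary abelian $2$-group. With $\operatorname{core}_G(H)=\bigcap_{g\in G}gHg^{-1}$, $\mathfrak n_G:\Omega(G)\to\Omega(G)$ is the additive map with $\mathfrak n_G([G/H])=[G/\operatorname{core}_G(H)]$, and $\mathcal U_{\mathrm{core}}(G):=\{u\in\Omega(G)^\times\mid\mathfrak n_G(u)=1_{\Omega(G)}\}$, the group of core-trivial units (a subgroup of $\Omega(G)^\times$). For a finite elementary abelian $2$-group $A$, $\operatorname{rank}(A):=\dim_{\mathbb F_2}A$. *)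

theory Defs
  imports
    "HOL-Algebra.Group_Action"
    "HOL-Algebra.Left_Coset"
    "HOL-Algebra.Product_Groups"
    "HOL-Algebra.Sym_Groups"
    "HOL-Number_Theory.Residues"
    "Jordan_Normal_Form.Missing_VectorSpace"
begin

section \<open>Finite $G$-sets\<close>

type_synonym ('a, 'x) gset = "'x set \<times> ('a \<Rightarrow> 'x \<Rightarrow> 'x)"

definition finite_gset :: "('a, 'b) monoid_scheme \<Rightarrow> ('a, 'x) gset \<Rightarrow> bool" where
  "finite_gset G S \<longleftrightarrow> finite (fst S) \<and> group_action G (fst S) (snd S)"

definition gset_iso ::
  "('a, 'b) monoid_scheme \<Rightarrow> ('a, 'x) gset \<Rightarrow> ('a, 'y) gset \<Rightarrow> bool" where
  "gset_iso G S T \<longleftrightarrow> (\<exists>f. bij_betw f (fst S) (fst T) \<and>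
     (\<forall>g \<in> carrier G. \<forall>x \<in> fst S. f (snd S g x) = snd T g (f x)))"

definition gset_empty :: "('a, 'x) gset" where
  "gset_empty = ({}, \<lambda>g. \<lambda>x \<in> {}. x)"

definition gset_sum :: "('a, 'x) gset \<Rightarrow> ('a, 'y) gset \<Rightarrow> ('a, 'x + 'y) gset" where
  "gset_sum S T = (Sum_Type.Plus (fst S) (fst T),
     \<lambda>g. \<lambda>z \<in> Sum_Type.Plus (fst S) (fst T). map_sum (snd S g) (snd T g) z)"

definition gset_prod :: "('a, 'x) gset \<Rightarrow> ('a, 'y) gset \<Rightarrow> ('a, 'x \<times> 'y) gset" where
  "gset_prod S T = (fst S \<times> fst T,
     \<lambda>g. \<lambda>z \<in> fst S \<times> fst T. map_prod (snd S g) (snd T g) z)"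

definition coset_gset :: "('a, 'b) monoid_scheme \<Rightarrow> 'a set \<Rightarrow> ('a, 'a set) gset" where
  "coset_gset G H = (lcosets\<^bsub>G\<^esub> H, \<lambda>g. \<lambda>C \<in> lcosets\<^bsub>G\<^esub> H. g <#\<^bsub>G\<^esub> C)"


section \<open>The Burnside ring\<close>

text \<open>
  \<open>gset_diff G A B\<close> is the formal difference $[A] - [B]$ in the Grothendieck ring, i.e. the set
  of all pairs $(C, D)$ of finite $G$-sets with $A + D + Z \cong C + B + Z$ for some finite
  $G$-set $Z$. The members of the class live on finite sets of natural numbers, which contain a
  representative of every isomorphism class of finite $G$-sets; $A$ and $B$ themselves may live
  on any types, so sums, products and coset spaces need not be re-encoded.
\<close>
definition gset_diff ::
  "('a, 'b) monoid_scheme \<Rightarrow> ('a, 'x) gset \<Rightarrow> ('a, 'y) gset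
     \<Rightarrow> (('a, nat) gset \<times> ('a, nat) gset) set" where
  "gset_diff G A B = {(C, D). finite_gset G C \<and> finite_gset G D \<and>
     (\<exists>Z :: ('a, nat) gset. finite_gset G Z \<and>
        gset_iso G (gset_sum (gset_sum A D) Z) (gset_sum (gset_sum C B) Z))}"

definition gset_class ::
  "('a, 'b) monoid_scheme \<Rightarrow> ('a, 'x) gset \<Rightarrow> (('a, nat) gset \<times> ('a, nat) gset) set" where
  "gset_class G S = gset_diff G S (gset_empty :: ('a, nat) gset)"

definition burnside_ring ::
  "('a, 'b) monoid_scheme \<Rightarrow> (('a, nat) gset \<times> ('a, nat) gset) set ring" where
  "burnside_ring G =
    \<lparr>carrier = {gset_diff G A B | (A :: ('a, nat) gset) (B :: ('a, nat) gset).
       finite_gset G A \<and> finite_gset G B},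
     monoid.mult = (\<lambda>P Q. \<Union>(A, B) \<in> P. \<Union>(C, D) \<in> Q.
       gset_diff G (gset_sum (gset_prod A C) (gset_prod B D))
                   (gset_sum (gset_prod A D) (gset_prod B C))),
     one = gset_class G (coset_gset G (carrier G)),
     zero = gset_class G (gset_empty :: ('a, nat) gset),
     add = (\<lambda>P Q. \<Union>(A, B) \<in> P. \<Union>(C, D) \<in> Q. gset_diff G (gset_sum A C) (gset_sum B D))\<rparr>"


section \<open>Core-trivial units\<close>

definition normal_core :: "('a, 'b) monoid_scheme \<Rightarrow> 'a set \<Rightarrow> 'a set" where
  "normal_core G H = (\<Inter>g \<in> carrier G. g <#\<^bsub>G\<^esub> H #>\<^bsub>G\<^esub> inv\<^bsub>G\<^esub> g)"

text \<open>
  The classes $[G/H]$ form a $\mathbb{Z}$-basis and conjugate subgroups have the same core, so the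
  following conditions determine a unique additive map; \<open>extensional\<close> fixes its (irrelevant)
  values outside the ring.
\<close>
definition core_map ::
  "('a, 'b) monoid_scheme \<Rightarrow> (('a, nat) gset \<times> ('a, nat) gset) set
     \<Rightarrow> (('a, nat) gset \<times> ('a, nat) gset) set" where
  "core_map G = (THE f.
     f \<in> hom (add_monoid (burnside_ring G)) (add_monoid (burnside_ring G)) \<and>
     f \<in> extensional (carrier (burnside_ring G)) \<and>
     (\<forall>H. subgroup H G \<longrightarrow>
        f (gset_class G (coset_gset G H)) = gset_class G (coset_gset G (normal_core G H))))"

definition core_trivial_units ::
  "('a, 'b) monoid_scheme \<Rightarrow> (('a, nat) gset \<times> ('a, nat) gset) set monoid" where
  "core_trivial_units G = (units_of (burnside_ring G))
     \<lparr>carrier := {u \<in> Units (burnside_ring G). core_map G u = \<one>\<^bsub>burnside_ring G\<^esub>}\<rparr>"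


section \<open>Rank of an elementary abelian 2-group\<close>

text \<open>
  An elementary abelian 2-group, written multiplicatively, as a vector space over
  \<open>residue_ring 2\<close>, the field with elements 0 and 1. The two ring multiplication fields of the
  module record play no role.
\<close>
definition F2_space :: "('a, 'b) monoid_scheme \<Rightarrow> (int, 'a) module" where
  "F2_space A = \<lparr>carrier = carrier A, monoid.mult = monoid.mult A, one = one A,
     zero = one A, add = monoid.mult A, smult = (\<lambda>k a. a [^]\<^bsub>A\<^esub> k)\<rparr>"

definition rank2 :: "('a, 'b) monoid_scheme \<Rightarrow> nat" where
  "rank2 A = vectorspace.dim (residue_ring 2) (F2_space A)"


section \<open>The groups $S_4^m$\<close>

definition S4_power :: "nat \<Rightarrow> (nat \<Rightarrow> nat \<Rightarrow> nat) monoid" where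
  "S4_power m = product_group {..<m} (\<lambda>_. sym_group 4)"

end

(*
  A finite G-set is determined up to isomorphism by its marks |X^K| (Burnside), so the Burnside
  ring is a ring of integer functions. By the orbit counting lemma the number of orbits of u^N,
  for N normal, is the average over g of the marks of u at N<g>. These orbit numbers determine
  and are determined by n_G(u), so n_G(u) = 1 iff all of them are 1; for a unit, whose marks are
  1 or -1, this means that all marks at subgroups N<g> are 1. That condition is multiplicative,
  hence the core-trivial units form an elementary abelian 2-group.

  The unit 1 - 2[S4/S3] + [S4/C3] + 2[S4/C2] - [S4/1] of the Burnside ring of S4 has mark -1 at S3
  and 1 at all other conjugacy classes of subgroups, and S3 is not of the form N<g>. Inflating it
  along the m projections gives m core-trivial units of S4^m, which are separated by the marks at
  the m factors S3.
*)
theory Submission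
  imports Defs
begin

section \<open>Finite $G$-sets and their marks\<close>

text \<open>A core-trivial unit other than 1 has mark -1 at some subgroup that is not of the form
  N<g> with N normal. S3 has no such subgroup. In S4 the point stabilizer S3 is one: it contains no
  nontrivial normal subgroup of S4, and it is not cyclic. Orbit numbers and \<open>core_map\<close>
  carry the same information because the kernel of the action on G/H is the core of H. So the
  coefficient of [G/M] in n_G(u) is the virtual number of orbits with kernel M, while u^N keeps
  exactly the orbits whose kernel contains N. Sums over M containing N are triangular for inclusion
  and can be inverted by induction, with no classification of subgroups. Since
  \<open>core_map\<close> is a definite description, both existence and uniqueness are at stake:
  existence comes from counting orbits by kernel, uniqueness from the fact that transitive G-sets
  generate the ring additively. No table of marks of S4 is computed. The marks of the unit are a
  polynomial in two numbers, the fixed points on four letters and on two signs, and only a few pairs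
  of values occur.\<close>

text \<open>The restriction makes every action map extensional on \<open>E\<close>, as membership in
  \<open>Bij E\<close> demands, while \<open>a\<close> may be any total function.\<close>

definition gset_of :: "'x set \<Rightarrow> ('a \<Rightarrow> 'x \<Rightarrow> 'x) \<Rightarrow> ('a, 'x) gset" where
  "gset_of E a = (E, \<lambda>g. \<lambda>x \<in> E. a g x)"

lemma fst_gset_of [simp]: "fst (gset_of E a) = E"
  and snd_gset_of [simp]: "x \<in> E \<Longrightarrow> snd (gset_of E a) g x = a g x"
  by (simp_all add: gset_of_def)

text \<open>Here $K$ is any set of group elements: its fixed points are those of the subgroup it
  generates, so that no generated subgroups have to be formed.\<close>
definition fixed_points :: "('a, 'x) gset \<Rightarrow> 'a set \<Rightarrow> 'x set" where
  "fixed_points S K = {x \<in> fst S. \<forall>k \<in> K. snd S k x = x}"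

definition mark :: "('a, 'x) gset \<Rightarrow> 'a set \<Rightarrow> int" where
  "mark S K = int (card (fixed_points S K))"

lemma fixed_points_gset_of: "fixed_points (gset_of E a) K = {x \<in> E. \<forall>k \<in> K. a k x = x}"
  by (auto simp: fixed_points_def)

lemma coset_gset_eq: "coset_gset G H = gset_of (lcosets\<^bsub>G\<^esub> H) (\<lambda>g C. g <#\<^bsub>G\<^esub> C)"
  by (simp add: coset_gset_def gset_of_def)

lemma gset_sum_eq:
  "gset_sum S T = gset_of (Sum_Type.Plus (fst S) (fst T)) (\<lambda>g. map_sum (snd S g) (snd T g))"
  by (simp add: gset_sum_def gset_of_def)

lemma gset_prod_eq:
  "gset_prod S T = gset_of (fst S \<times> fst T) (\<lambda>g. map_prod (snd S g) (snd T g))"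
  by (simp add: gset_prod_def gset_of_def)

lemma gset_empty_eq: "gset_empty = gset_of {} (\<lambda>g x. x)"
  by (simp add: gset_empty_def gset_of_def)

lemma mark_gset_empty [simp]: "mark gset_empty K = 0"
  by (simp add: mark_def gset_empty_eq fixed_points_gset_of)

lemma finite_fixed_points: "finite_gset G S \<Longrightarrow> finite (fixed_points S K)"
  by (simp add: finite_gset_def fixed_points_def)

lemma mark_gset_prod: "mark (gset_prod S T) K = mark S K * mark T K"
proof -
  have "fixed_points (gset_prod S T) K = fixed_points S K \<times> fixed_points T K"
    unfolding gset_prod_eq fixed_points_gset_of unfolding fixed_points_def by auto
  then show ?thesis
    by (simp add: mark_def card_cartesian_product)
qed

locale fin_group = group +
  assumes fin: "finite (carrier G)"
begin

text \<open>Each map is bijective because the inverse group element undoes it, so closure and the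
  two pointwise laws suffice and \<open>BijGroup\<close> can stay out of the later
  constructions.\<close>

lemma finite_gset_gset_of:
  assumes "finite E" and cl: "\<And>g x. g \<in> carrier G \<Longrightarrow> x \<in> E \<Longrightarrow> a g x \<in> E"
    and one: "\<And>x. x \<in> E \<Longrightarrow> a \<one> x = x"
    and mult: "\<And>g h x. g \<in> carrier G \<Longrightarrow> h \<in> carrier G \<Longrightarrow> x \<in> E \<Longrightarrow> a (g \<otimes> h) x = a g (a h x)"
  shows "finite_gset G (gset_of E a)"
proof -
  have Bij: "(\<lambda>x\<in>E. a g x) \<in> Bij E" if g: "g \<in> carrier G" for g
  proof -
    have "bij_betw (\<lambda>x\<in>E. a g x) E E"
    proof (rule bij_betw_byWitness[where f' = "a (inv g)"])
      show "\<forall>x\<in>E. a (inv g) ((\<lambda>x\<in>E. a g x) x) = x"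
        using mult[of "inv g" g] g one by auto
      show "\<forall>x\<in>E. (\<lambda>x\<in>E. a g x) (a (inv g) x) = x"
        using mult[of g "inv g"] g one cl[of "inv g"] by auto
    qed (use cl g in auto)
    then show ?thesis by (simp add: Bij_def)
  qed
  have "group_hom G (BijGroup E) (\<lambda>g. \<lambda>x\<in>E. a g x)"
  proof (intro group_hom.intro group_hom_axioms.intro group_BijGroup is_group homI)
    fix g h assume gh: "g \<in> carrier G" "h \<in> carrier G"
    have "(\<lambda>x\<in>E. a (g \<otimes> h) x) = compose E (\<lambda>x\<in>E. a g x) (\<lambda>x\<in>E. a h x)"
      using gh mult cl by (auto simp: compose_def fun_eq_iff)
    then show "(\<lambda>x\<in>E. a (g \<otimes> h) x) = (\<lambda>x\<in>E. a g x) \<otimes>\<^bsub>BijGroup E\<^esub> (\<lambda>x\<in>E. a h x)"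
      using gh Bij by (simp add: BijGroup_def)
  qed (use Bij in \<open>simp add: BijGroup_def\<close>)
  then show ?thesis
    using assms(1) by (simp add: finite_gset_def gset_of_def group_action_def)
qed

context
  fixes S :: "('a, 'x) gset"
  assumes S: "finite_gset G S"
begin

interpretation group_action G "fst S" "snd S"
  using S by (simp add: finite_gset_def)

lemma finite_gset_finite: "finite (fst S)"
  using S by (simp add: finite_gset_def)

lemma gset_act_closed: "g \<in> carrier G \<Longrightarrow> x \<in> fst S \<Longrightarrow> snd S g x \<in> fst S"
  using element_image by blast

lemma gset_act_one: "x \<in> fst S \<Longrightarrow> snd S \<one> x = x"
  using id_eq_one by (metis restrict_apply')

lemma gset_act_mult:
  "g \<in> carrier G \<Longrightarrow> h \<in> carrier G \<Longrightarrow> x \<in> fst S \<Longrightarrow> snd S (g \<otimes> h) x = snd S g (snd S h x)"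
  by (rule composition_rule)

lemma gset_act_inv: "g \<in> carrier G \<Longrightarrow> x \<in> fst S \<Longrightarrow> snd S (inv g) (snd S g x) = x"
  using orbit_sym_aux by blast

lemma gset_act_inv': "g \<in> carrier G \<Longrightarrow> x \<in> fst S \<Longrightarrow> snd S g (snd S (inv g) x) = x"
  using gset_act_one by (simp flip: gset_act_mult)

lemma gset_stabilizer_subgroup: "x \<in> fst S \<Longrightarrow> subgroup (stabilizer G (snd S) x) G"
  by (rule stabilizer_subgroup)

lemma gset_orbit_subset: "x \<in> fst S \<Longrightarrow> orbit G (snd S) x \<subseteq> fst S"
  using gset_act_closed by (auto simp: orbit_def)

lemma gset_orbit_refl: "x \<in> fst S \<Longrightarrow> x \<in> orbit G (snd S) x"
  by (rule orbit_refl)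

lemma gset_orbit_closed:
  "x \<in> fst S \<Longrightarrow> g \<in> carrier G \<Longrightarrow> y \<in> orbit G (snd S) x \<Longrightarrow> snd S g y \<in> orbit G (snd S) x"
  unfolding orbit_def by (auto simp flip: gset_act_mult)

lemma finite_gset_sub:
  assumes "E \<subseteq> fst S" "\<And>g x. g \<in> carrier G \<Longrightarrow> x \<in> E \<Longrightarrow> snd S g x \<in> E"
  shows "finite_gset G (gset_of E (snd S))"
  using assms finite_subset[OF assms(1) finite_gset_finite]
  by (intro finite_gset_gset_of) (auto intro: gset_act_one gset_act_mult)

end

section \<open>Sums, products and coset spaces\<close>

lemma finite_gset_empty [simp]: "finite_gset G gset_empty"
  unfolding gset_empty_eq by (rule finite_gset_gset_of) auto

lemma finite_gset_sum [simp]: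
  "finite_gset G S \<Longrightarrow> finite_gset G T \<Longrightarrow> finite_gset G (gset_sum S T)"
  unfolding gset_sum_eq
  by (rule finite_gset_gset_of)
    (auto simp: finite_gset_finite gset_act_closed gset_act_one gset_act_mult)

lemma finite_gset_prod [simp]:
  "finite_gset G S \<Longrightarrow> finite_gset G T \<Longrightarrow> finite_gset G (gset_prod S T)"
  unfolding gset_prod_eq
  by (rule finite_gset_gset_of)
    (auto simp: finite_gset_finite gset_act_closed gset_act_one gset_act_mult)

lemma finite_gset_coset [simp]:
  assumes "subgroup H G"
  shows "finite_gset G (coset_gset G H)"
  unfolding coset_gset_eq
proof (rule finite_gset_gset_of)
  have H: "H \<subseteq> carrier G" by (rule subgroup.subset[OF assms])
  show "finite (lcosets H)"
    using fin by (simp add: LCOSETS_def)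
  show "g <# C \<in> lcosets H" if "g \<in> carrier G" "C \<in> lcosets H" for g C
    using that H by (auto simp: LCOSETS_def lcos_m_assoc)
  have sub: "C \<subseteq> carrier G" if "C \<in> lcosets H" for C
    using that lcosets_subset_PowG[OF assms] by auto
  show "\<one> <# C = C" if "C \<in> lcosets H" for C
    using sub[OF that] by (simp add: lcos_mult_one)
  show "g \<otimes> h <# C = g <# (h <# C)" if "g \<in> carrier G" "h \<in> carrier G" "C \<in> lcosets H" for g h C
    using that sub by (simp add: lcos_m_assoc)
qed

lemma mark_gset_sum:
  assumes "finite_gset G S" "finite_gset G T"
  shows "mark (gset_sum S T) K = mark S K + mark T K"
proof -
  have "fixed_points (gset_sum S T) K = fixed_points S K <+> fixed_points T K"
    unfolding gset_sum_eq fixed_points_gset_of unfolding fixed_points_def by auto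
  then show ?thesis
    using assms by (simp add: mark_def card_Plus finite_fixed_points)
qed

lemma mark_gset_iso:
  assumes "gset_iso G S T" "K \<subseteq> carrier G" and S: "finite_gset G S"
  shows "mark S K = mark T K"
proof -
  obtain f where f: "bij_betw f (fst S) (fst T)"
    and eq: "\<And>g x. g \<in> carrier G \<Longrightarrow> x \<in> fst S \<Longrightarrow> f (snd S g x) = snd T g (f x)"
    using assms(1) by (auto simp: gset_iso_def)
  have "bij_betw f (fixed_points S K) (fixed_points T K)"
  proof (rule bij_betw_subset[OF f])
    show "fixed_points S K \<subseteq> fst S"
      by (auto simp: fixed_points_def)
    have "f x \<in> fixed_points T K \<longleftrightarrow> x \<in> fixed_points S K" if x: "x \<in> fst S" for x
    proof -
      have "snd T k (f x) = f x \<longleftrightarrow> snd S k x = x" if "k \<in> K" for k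
        using that x assms(2) eq[of k x] gset_act_closed[OF S, of k x] f
        by (auto simp: bij_betw_def inj_on_def)
      then show ?thesis
        using x bij_betwE[OF f] by (auto simp: fixed_points_def)
    qed
    moreover have "fixed_points T K \<subseteq> f ` fst S"
      using f by (auto simp: bij_betw_def fixed_points_def)
    ultimately show "f ` fixed_points S K = fixed_points T K"
      using \<open>fixed_points S K \<subseteq> fst S\<close> by blast
  qed
  then show ?thesis
    by (simp add: mark_def bij_betw_same_card)
qed

text \<open>Transport of structure along an injection into the naturals; this connects $G$-sets on
  arbitrary types with the representatives allowed in the ring.\<close>

lemma nat_gset_exists:
  assumes "finite_gset G S"
  obtains T :: "('a, nat) gset" where "finite_gset G T" "gset_iso G S T"
proof -
  note [simp] = finite_gset_finite[OF assms]
    gset_act_closed[OF assms] gset_act_one[OF assms] gset_act_mult[OF assms]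
  obtain f :: "_ \<Rightarrow> nat" where f: "inj_on f (fst S)"
    using finite_imp_inj_to_nat_seg[of "fst S"] by auto
  define T where "T = gset_of (f ` fst S) (\<lambda>g y. f (snd S g (inv_into (fst S) f y)))"
  have "finite_gset G T"
    unfolding T_def using f by (intro finite_gset_gset_of) auto
  moreover have "gset_iso G S T"
    unfolding gset_iso_def T_def using f by (intro exI[of _ f]) (auto simp: bij_betw_def)
  ultimately show ?thesis by (rule that)
qed

section \<open>Orbits, stabilizers and Burnside's theorem that marks determine a $G$-set\<close>

lemma gset_act_eq_iff:
  assumes S: "finite_gset G S" and x: "x \<in> fst S" and g: "g \<in> carrier G" and h: "h \<in> carrier G"
  shows "snd S g x = snd S h x \<longleftrightarrow> inv h \<otimes> g \<in> stabilizer G (snd S) x"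
proof -
  have "snd S (inv h \<otimes> g) x = snd S (inv h) (snd S g x)"
    using S x g h by (simp add: gset_act_mult)
  moreover have "snd S h (snd S (inv h) (snd S g x)) = snd S g x"
    using S x g h by (simp add: gset_act_inv' gset_act_closed)
  moreover have "snd S (inv h) (snd S h x) = x"
    using S x h by (simp add: gset_act_inv)
  ultimately show ?thesis
    using g h by (auto simp: stabilizer_def)
qed

text \<open>Which group elements agree at a point depends only on its stabilizer, so sending g x to
  g y is well defined and injective.\<close>

lemma gset_iso_orbits:
  assumes S: "finite_gset G S" and T: "finite_gset G T" and x: "x \<in> fst S" and y: "y \<in> fst T"
    and stab: "stabilizer G (snd S) x = stabilizer G (snd T) y"
  shows "gset_iso G (gset_of (orbit G (snd S) x) (snd S)) (gset_of (orbit G (snd T) y) (snd T))"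
proof -
  have iff: "snd S g x = snd S h x \<longleftrightarrow> snd T g y = snd T h y"
    if "g \<in> carrier G" "h \<in> carrier G" for g h
    using that by (simp add: gset_act_eq_iff[OF S x] gset_act_eq_iff[OF T y] stab)
  \<comment> \<open>The choice picks some g carrying x to z; by \<open>iff\<close> the value does
    not depend on which.\<close>
  define f where "f z = snd T (SOME g. g \<in> carrier G \<and> snd S g x = z) y" for z
  have f: "f (snd S g x) = snd T g y" if g: "g \<in> carrier G" for g
  proof -
    have "(SOME h. h \<in> carrier G \<and> snd S h x = snd S g x) \<in> carrier G \<and>
          snd S (SOME h. h \<in> carrier G \<and> snd S h x = snd S g x) x = snd S g x"
      by (rule someI[of _ g]) (use g in simp)
    then show ?thesis
      using iff g by (auto simp: f_def)
  qed
  have "bij_betw f (orbit G (snd S) x) (orbit G (snd T) y)"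
    unfolding bij_betw_def
  proof
    show "inj_on f (orbit G (snd S) x)"
      using f iff by (auto simp: inj_on_def orbit_def)
    show "f ` orbit G (snd S) x = orbit G (snd T) y"
      using f by (force simp: orbit_def)
  qed
  moreover have "f (snd S k z) = snd T k (f z)"
    if "k \<in> carrier G" "z \<in> orbit G (snd S) x" for k z
  proof -
    obtain g where g: "g \<in> carrier G" "z = snd S g x"
      using \<open>z \<in> _\<close> by (auto simp: orbit_def)
    then show ?thesis
      using that f S T x y by (simp flip: gset_act_mult)
  qed
  moreover have "f z \<in> orbit G (snd T) y" if "z \<in> orbit G (snd S) x" for z
    using that f by (auto simp: orbit_def)
  ultimately show ?thesis
    unfolding gset_iso_def by (intro exI[of _ f]) simp
qed

lemma gset_complement_closed:
  assumes S: "finite_gset G S" and E: "E \<subseteq> fst S" "\<And>g x. g \<in> carrier G \<Longrightarrow> x \<in> E \<Longrightarrow> snd S g x \<in> E"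
    and g: "g \<in> carrier G" and x: "x \<in> fst S - E"
  shows "snd S g x \<in> fst S - E"
  using E(2)[of "inv g" "snd S g x"] gset_act_inv[OF S g, of x] gset_act_closed[OF S g, of x] g x
  by auto

lemma mark_split:
  assumes "finite_gset G S" "E \<subseteq> fst S"
  shows "mark S K = mark (gset_of E (snd S)) K + mark (gset_of (fst S - E) (snd S)) K"
proof -
  have "fixed_points S K = fixed_points (gset_of E (snd S)) K \<union> fixed_points (gset_of (fst S - E) (snd S)) K"
    unfolding fixed_points_gset_of unfolding fixed_points_def using assms(2) by auto
  moreover have "finite (fst S)" "finite E"
    using assms finite_gset_finite finite_subset by blast+
  ultimately show ?thesis
    unfolding mark_def fixed_points_gset_of
    by (simp add: card_Un_disjoint disjoint_iff)
qed

lemma gset_iso_glue: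
  assumes "gset_iso G (gset_of E (snd S)) (gset_of F (snd T))"
    and "gset_iso G (gset_of (fst S - E) (snd S)) (gset_of (fst T - F) (snd T))"
    and "E \<subseteq> fst S" "F \<subseteq> fst T"
    and S: "finite_gset G S" and E: "\<And>g x. g \<in> carrier G \<Longrightarrow> x \<in> E \<Longrightarrow> snd S g x \<in> E"
  shows "gset_iso G S T"
proof -
  obtain f where f: "bij_betw f E F"
    and eq: "\<And>g x. g \<in> carrier G \<Longrightarrow> x \<in> E \<Longrightarrow> f (snd S g x) = snd (gset_of F (snd T)) g (f x)"
    using assms(1) by (auto simp: gset_iso_def)
  obtain f' where f': "bij_betw f' (fst S - E) (fst T - F)"
    and eq': "\<And>g x. g \<in> carrier G \<Longrightarrow> x \<in> fst S - E \<Longrightarrow>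
      f' (snd S g x) = snd (gset_of (fst T - F) (snd T)) g (f' x)"
    using assms(2) by (auto simp: gset_iso_def)
  define h where "h x = (if x \<in> E then f x else f' x)" for x
  have "bij_betw h E F"
    using f by (rule bij_betw_cong[THEN iffD1, rotated]) (simp add: h_def)
  moreover have "bij_betw h (fst S - E) (fst T - F)"
    using f' by (rule bij_betw_cong[THEN iffD1, rotated]) (simp add: h_def)
  ultimately have "bij_betw h (E \<union> (fst S - E)) (F \<union> (fst T - F))"
    by (rule bij_betw_combine) auto
  then have "bij_betw h (fst S) (fst T)"
    using assms(3,4) by (simp add: Un_absorb1 Un_Diff_cancel)
  moreover have "h (snd S g x) = snd T g (h x)" if g: "g \<in> carrier G" and x: "x \<in> fst S" for g x
    using gset_complement_closed[OF S assms(3) E g, of x] E[OF g, of x] eq[OF g, of x] eq'[OF g, of x] x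
      bij_betwE[OF f] bij_betwE[OF f']
    by (auto simp: h_def)
  ultimately show ?thesis
    by (auto simp: gset_iso_def)
qed

text \<open>A largest subset with a fixed point is the full stabilizer of each of its fixed points, in
  both $G$-sets; hence the two $G$-sets have an orbit in common, which can be split off.\<close>
theorem gset_iso_if_marks_eq:
  assumes "finite_gset G S" "finite_gset G T" "\<And>K. K \<subseteq> carrier G \<Longrightarrow> mark S K = mark T K"
  shows "gset_iso G S T"
  using assms
proof (induction "card (fst S)" arbitrary: S T rule: less_induct)
  case less
  note S = less.prems(1) and T = less.prems(2) and marks = less.prems(3)
  note finS = finite_gset_finite[OF S] and finT = finite_gset_finite[OF T]
  show ?case
  proof (cases "fst S = {}")
    case True
    then have "mark T {} = 0"
      using marks[of "{}"] by (simp add: mark_def fixed_points_def)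
    then have "fst T = {}"
      using finT by (simp add: mark_def fixed_points_def)
    with True show ?thesis
      by (simp add: gset_iso_def bij_betw_def)
  next
    case False
    define P where "P K \<longleftrightarrow> K \<subseteq> carrier G \<and> fixed_points S K \<noteq> {}" for K
    have "P {}" using False by (auto simp: P_def fixed_points_def)
    moreover have "\<forall>K. P K \<longrightarrow> card K \<le> card (carrier G)"
      using fin by (auto simp: P_def card_mono)
    ultimately obtain K where K: "P K" and max: "\<And>K'. P K' \<Longrightarrow> card K' \<le> card K"
      using ex_has_greatest_nat[of P "{}" card] by (metis less_Suc_eq_le le_imp_less_Suc)
    \<comment> \<open>Equal marks make \<open>P\<close> symmetric in the two $G$-sets, so a
      \<open>K\<close> of maximal size for \<open>S\<close> is also maximal for \<open>T\<close>.
      Maximality then forces \<open>K\<close>, a priori a mere subset, to be the stabilizer on both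
      sides.\<close>
    have PT: "P K' \<longleftrightarrow> K' \<subseteq> carrier G \<and> fixed_points T K' \<noteq> {}" for K'
      using marks[of K'] finite_fixed_points[OF S, of K'] finite_fixed_points[OF T, of K']
      unfolding P_def mark_def by auto
    obtain x where x: "x \<in> fixed_points S K" using K by (auto simp: P_def)
    obtain y where y: "y \<in> fixed_points T K" using K by (auto simp: PT)
    have xS: "x \<in> fst S" and yT: "y \<in> fst T" using x y by (auto simp: fixed_points_def)
    have "stabilizer G (snd S) x = K"
    proof (rule card_seteq[symmetric])
      show "K \<subseteq> stabilizer G (snd S) x"
        using x K by (auto simp: fixed_points_def stabilizer_def P_def)
      have "x \<in> fixed_points S (stabilizer G (snd S) x)"
        using xS by (auto simp: fixed_points_def stabilizer_def)
      then have "P (stabilizer G (snd S) x)"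
        by (auto simp: P_def stabilizer_def)
      then show "card (stabilizer G (snd S) x) \<le> card K" by (rule max)
      show "finite (stabilizer G (snd S) x)"
        using fin by (simp add: stabilizer_def)
    qed
    moreover have "stabilizer G (snd T) y = K"
    proof (rule card_seteq[symmetric])
      show "K \<subseteq> stabilizer G (snd T) y"
        using y K by (auto simp: fixed_points_def stabilizer_def P_def)
      have "y \<in> fixed_points T (stabilizer G (snd T) y)"
        using yT by (auto simp: fixed_points_def stabilizer_def)
      then have "P (stabilizer G (snd T) y)"
        by (auto simp: PT stabilizer_def)
      then show "card (stabilizer G (snd T) y) \<le> card K" by (rule max)
      show "finite (stabilizer G (snd T) y)"
        using fin by (simp add: stabilizer_def)
    qed
    ultimately have iso: "gset_iso G (gset_of (orbit G (snd S) x) (snd S)) (gset_of (orbit G (snd T) y) (snd T))"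
      (is "gset_iso G ?OS ?OT")
      using gset_iso_orbits[OF S T xS yT] by simp
    let ?S = "gset_of (fst S - orbit G (snd S) x) (snd S)"
    let ?T = "gset_of (fst T - orbit G (snd T) y) (snd T)"
    note subS = gset_orbit_subset[OF S xS] and subT = gset_orbit_subset[OF T yT]
    note clS = gset_orbit_closed[OF S xS] and clT = gset_orbit_closed[OF T yT]
    have "gset_iso G ?S ?T"
    proof (rule less.hyps)
      show "card (fst ?S) < card (fst S)"
        using finS gset_orbit_refl[OF S xS] xS by (auto intro!: psubset_card_mono)
      show "finite_gset G ?S"
        by (rule finite_gset_sub[OF S]) (use gset_complement_closed[OF S subS clS] in auto)
      show "finite_gset G ?T"
        by (rule finite_gset_sub[OF T]) (use gset_complement_closed[OF T subT clT] in auto)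
      fix K' assume K': "K' \<subseteq> carrier G"
      have "mark ?OS K' = mark ?OT K'"
        by (rule mark_gset_iso[OF iso K' finite_gset_sub[OF S subS clS]])
      then show "mark ?S K' = mark ?T K'"
        using marks[OF K'] mark_split[OF S subS, of K'] mark_split[OF T subT, of K'] by simp
    qed
    then show ?thesis
      by (rule gset_iso_glue[OF iso _ subS subT S clS])
  qed
qed

text \<open>Marks of the auxiliary summand \<open>Z\<close> cancel in the integers; conversely equal
  marks already give an isomorphism, so \<open>Z\<close> can be taken empty.\<close>

lemma gset_diff_eq:
  assumes "finite_gset G A" "finite_gset G B"
  shows "gset_diff G A B = {(C, D). finite_gset G C \<and> finite_gset G D \<and>
    (\<forall>K \<subseteq> carrier G. mark A K - mark B K = mark C K - mark D K)}"
proof -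
  have "(\<exists>Z :: ('a, nat) gset. finite_gset G Z \<and>
          gset_iso G (gset_sum (gset_sum A D) Z) (gset_sum (gset_sum C B) Z)) \<longleftrightarrow>
        (\<forall>K \<subseteq> carrier G. mark A K - mark B K = mark C K - mark D K)" (is "?l \<longleftrightarrow> ?r")
    if "finite_gset G C" "finite_gset G D" for C D :: "('a, nat) gset"
  proof
    assume ?l
    then obtain Z :: "('a, nat) gset" where "finite_gset G Z"
      "gset_iso G (gset_sum (gset_sum A D) Z) (gset_sum (gset_sum C B) Z)" by blast
    then have *: "mark (gset_sum (gset_sum A D) Z) K = mark (gset_sum (gset_sum C B) Z) K"
      if "K \<subseteq> carrier G" for K
      using mark_gset_iso that \<open>finite_gset G D\<close> assms by (metis finite_gset_sum)
    have "mark A K + mark D K = mark C K + mark B K" if "K \<subseteq> carrier G" for K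
      using *[OF that] \<open>finite_gset G C\<close> \<open>finite_gset G D\<close> \<open>finite_gset G Z\<close> assms
      by (simp add: mark_gset_sum)
    then show ?r by force
  next
    assume r: ?r
    have "gset_iso G (gset_sum (gset_sum A D) (gset_empty :: ('a, nat) gset))
       (gset_sum (gset_sum C B) (gset_empty :: ('a, nat) gset))"
    proof (rule gset_iso_if_marks_eq)
      fix K assume "K \<subseteq> carrier G"
      then have "mark A K - mark B K = mark C K - mark D K" using r by blast
      then show "mark (gset_sum (gset_sum A D) (gset_empty :: ('a, nat) gset)) K =
          mark (gset_sum (gset_sum C B) (gset_empty :: ('a, nat) gset)) K"
        using that assms by (simp add: mark_gset_sum)
    qed (use that assms in simp_all)
    then show ?l by (meson finite_gset_empty)
  qed
  then show ?thesis
    unfolding gset_diff_def by blast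
qed

end

section \<open>The Burnside ring as a ring of mark functions\<close>

text \<open>The mark homomorphism on virtual $G$-sets. For \<open>K\<close> inside the group the
  difference is constant on a class of the ring, so the choice of representative is
  harmless.\<close>

definition vmark :: "(('a, nat) gset \<times> ('a, nat) gset) set \<Rightarrow> 'a set \<Rightarrow> int" where
  "vmark P K = (case SOME p. p \<in> P of (A, B) \<Rightarrow> mark A K - mark B K)"

text \<open>The ring operations are unions over all representatives. Independence of representatives
  collapses such a union to a single class, and the two given members keep it from being
  empty.\<close>

lemma UN_UN_const:
  assumes "(A0, B0) \<in> P" "(C0, D0) \<in> Q"
    and "\<And>A B C D. (A, B) \<in> P \<Longrightarrow> (C, D) \<in> Q \<Longrightarrow> F A B C D = X"
  shows "(\<Union>(A, B) \<in> P. \<Union>(C, D) \<in> Q. F A B C D) = X"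
proof -
  have "(\<Union>(A, B) \<in> P. \<Union>(C, D) \<in> Q. F A B C D) = (\<Union>p \<in> P. \<Union>q \<in> Q. X)"
    by (intro SUP_cong refl) (auto simp: assms(3))
  also have "\<dots> = X"
    using assms(1,2) by auto
  finally show ?thesis .
qed

context fin_group begin

abbreviation R where "R \<equiv> burnside_ring G"

lemma gset_diff_cong:
  assumes "finite_gset G A" "finite_gset G B" "finite_gset G A'" "finite_gset G B'"
    and "\<And>K. K \<subseteq> carrier G \<Longrightarrow> mark A K - mark B K = mark A' K - mark B' K"
  shows "gset_diff G A B = gset_diff G A' B'"
  using assms by (auto simp: gset_diff_eq)

text \<open>Moving both $G$-sets to the naturals exhibits a member of the class, so that choosing a
  representative is meaningful.\<close>

lemma nat_gset_diff:
  assumes A: "finite_gset G A" and B: "finite_gset G B"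
  obtains C D :: "('a, nat) gset" where "finite_gset G C" "finite_gset G D" "(C, D) \<in> gset_diff G A B"
    "gset_diff G A B = gset_diff G C D"
proof -
  obtain C :: "('a, nat) gset" where C: "finite_gset G C" "gset_iso G A C"
    using nat_gset_exists[OF A] .
  obtain D :: "('a, nat) gset" where D: "finite_gset G D" "gset_iso G B D"
    using nat_gset_exists[OF B] .
  have *: "mark A K - mark B K = mark C K - mark D K" if "K \<subseteq> carrier G" for K
    using mark_gset_iso[OF C(2) that A] mark_gset_iso[OF D(2) that B] by simp
  have "gset_diff G A B = gset_diff G C D"
    by (rule gset_diff_cong[OF A B C(1) D(1) *])
  moreover have "(C, D) \<in> gset_diff G C D"
    using C D by (simp add: gset_diff_eq)
  ultimately show ?thesis
    using C D that by simp
qed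

lemma vmark_eqI:
  assumes "p \<in> P" "\<And>A B. (A, B) \<in> P \<Longrightarrow> mark A K - mark B K = v"
  shows "vmark P K = v"
proof -
  have "(SOME p. p \<in> P) \<in> P" by (rule someI, rule assms(1))
  then show ?thesis
    unfolding vmark_def using assms(2) by (cases "SOME p. p \<in> P") auto
qed

lemma vmark_gset_diff:
  assumes "finite_gset G A" "finite_gset G B" "K \<subseteq> carrier G"
  shows "vmark (gset_diff G A B) K = mark A K - mark B K"
proof -
  obtain C D :: "('a, nat) gset" where "(C, D) \<in> gset_diff G A B"
    using nat_gset_diff[OF assms(1,2)] by metis
  then show ?thesis
    by (rule vmark_eqI) (use assms in \<open>auto simp: gset_diff_eq\<close>)
qed

lemma gset_diff_in_R:
  assumes A: "finite_gset G A" and B: "finite_gset G B"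
  shows "gset_diff G A B \<in> carrier R"
  using nat_gset_diff[OF A B] by (fastforce simp: burnside_ring_def)

lemma carrier_RE:
  assumes "P \<in> carrier R"
  obtains A B :: "('a, nat) gset" where "finite_gset G A" "finite_gset G B" "P = gset_diff G A B"
  using assms by (auto simp: burnside_ring_def)

lemma carrier_R_mem:
  assumes "P \<in> carrier R" "(A, B) \<in> P"
  shows "finite_gset G A" "finite_gset G B"
    and "K \<subseteq> carrier G \<Longrightarrow> mark A K - mark B K = vmark P K"
proof -
  obtain C D :: "('a, nat) gset" where "finite_gset G C" "finite_gset G D" "P = gset_diff G C D"
    using carrier_RE[OF assms(1)] .
  with assms(2) show "finite_gset G A" "finite_gset G B"
    "K \<subseteq> carrier G \<Longrightarrow> mark A K - mark B K = vmark P K"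
    by (auto simp: vmark_gset_diff) (auto simp: gset_diff_eq)
qed

text \<open>Injectivity of the mark homomorphism. Identities between ring elements, including the
  group laws for units, thereby become identities between integers.\<close>

lemma burnside_ring_eqI:
  assumes "P \<in> carrier R" "Q \<in> carrier R" "\<And>K. K \<subseteq> carrier G \<Longrightarrow> vmark P K = vmark Q K"
  shows "P = Q"
proof -
  obtain A B :: "('a, nat) gset" where AB: "finite_gset G A" "finite_gset G B" "P = gset_diff G A B"
    using carrier_RE[OF assms(1)] .
  obtain C D :: "('a, nat) gset" where CD: "finite_gset G C" "finite_gset G D" "Q = gset_diff G C D"
    using carrier_RE[OF assms(2)] .
  show ?thesis
    unfolding AB(3) CD(3)
    by (rule gset_diff_cong) (use AB CD assms(3) in \<open>simp_all add: vmark_gset_diff\<close>)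
qed

lemma
  assumes P: "P \<in> carrier R" and Q: "Q \<in> carrier R"
  shows burnside_mult_closed: "P \<otimes>\<^bsub>R\<^esub> Q \<in> carrier R"
    and vmark_mult: "\<And>K. K \<subseteq> carrier G \<Longrightarrow> vmark (P \<otimes>\<^bsub>R\<^esub> Q) K = vmark P K * vmark Q K"
    and burnside_add_closed: "P \<oplus>\<^bsub>R\<^esub> Q \<in> carrier R"
    and vmark_add: "\<And>K. K \<subseteq> carrier G \<Longrightarrow> vmark (P \<oplus>\<^bsub>R\<^esub> Q) K = vmark P K + vmark Q K"
proof -
  obtain A B :: "('a, nat) gset" where AB: "(A, B) \<in> P"
    using carrier_RE[OF P] nat_gset_diff by metis
  obtain C D :: "('a, nat) gset" where CD: "(C, D) \<in> Q"
    using carrier_RE[OF Q] nat_gset_diff by metis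
  note finP = carrier_R_mem(1,2)[OF P] and finQ = carrier_R_mem(1,2)[OF Q]
  note fins = finP[OF AB] finQ[OF CD]
  have prod_eq: "mark A K * mark C K + mark B K * mark D K - (mark A K * mark D K + mark B K * mark C K) =
      vmark P K * vmark Q K" if "K \<subseteq> carrier G" "(A, B) \<in> P" "(C, D) \<in> Q" for A B C D K
    using carrier_R_mem(3)[OF P that(2,1)] carrier_R_mem(3)[OF Q that(3,1)]
    by (simp add: algebra_simps)
  have mult: "P \<otimes>\<^bsub>R\<^esub> Q =
      gset_diff G (gset_sum (gset_prod A C) (gset_prod B D)) (gset_sum (gset_prod A D) (gset_prod B C))"
    unfolding burnside_ring_def monoid.simps
  proof (rule UN_UN_const[OF AB CD])
    fix A' B' C' D' assume AB': "(A', B') \<in> P" and CD': "(C', D') \<in> Q"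
    show "gset_diff G (gset_sum (gset_prod A' C') (gset_prod B' D')) (gset_sum (gset_prod A' D') (gset_prod B' C'))
      = gset_diff G (gset_sum (gset_prod A C) (gset_prod B D)) (gset_sum (gset_prod A D) (gset_prod B C))"
    proof (rule gset_diff_cong)
      fix K assume K: "K \<subseteq> carrier G"
      show "mark (gset_sum (gset_prod A' C') (gset_prod B' D')) K - mark (gset_sum (gset_prod A' D') (gset_prod B' C')) K
        = mark (gset_sum (gset_prod A C) (gset_prod B D)) K - mark (gset_sum (gset_prod A D) (gset_prod B C)) K"
        using prod_eq[OF K AB CD] prod_eq[OF K AB' CD'] finP[OF AB'] finQ[OF CD'] fins
        by (simp add: mark_gset_sum mark_gset_prod)
    qed (simp_all add: finP[OF AB'] finQ[OF CD'] fins)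
  qed
  have add: "P \<oplus>\<^bsub>R\<^esub> Q = gset_diff G (gset_sum A C) (gset_sum B D)"
    unfolding burnside_ring_def ring.simps
  proof (rule UN_UN_const[OF AB CD])
    fix A' B' C' D' assume AB': "(A', B') \<in> P" and CD': "(C', D') \<in> Q"
    show "gset_diff G (gset_sum A' C') (gset_sum B' D') = gset_diff G (gset_sum A C) (gset_sum B D)"
    proof (rule gset_diff_cong)
      fix K assume K: "K \<subseteq> carrier G"
      show "mark (gset_sum A' C') K - mark (gset_sum B' D') K =
          mark (gset_sum A C) K - mark (gset_sum B D) K"
        using carrier_R_mem(3)[OF P AB K] carrier_R_mem(3)[OF Q CD K]
          carrier_R_mem(3)[OF P AB' K] carrier_R_mem(3)[OF Q CD' K] finP[OF AB'] finQ[OF CD'] fins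
        by (simp add: mark_gset_sum)
    qed (simp_all add: finP[OF AB'] finQ[OF CD'] fins)
  qed
  show "P \<otimes>\<^bsub>R\<^esub> Q \<in> carrier R" "P \<oplus>\<^bsub>R\<^esub> Q \<in> carrier R"
    unfolding mult add using fins by (auto intro!: gset_diff_in_R)
  fix K assume K: "K \<subseteq> carrier G"
  show "vmark (P \<otimes>\<^bsub>R\<^esub> Q) K = vmark P K * vmark Q K"
    unfolding mult using fins K prod_eq[OF K AB CD]
    by (simp add: vmark_gset_diff mark_gset_sum mark_gset_prod)
  show "vmark (P \<oplus>\<^bsub>R\<^esub> Q) K = vmark P K + vmark Q K"
    unfolding add using fins K carrier_R_mem(3)[OF P AB K] carrier_R_mem(3)[OF Q CD K]
    by (simp add: vmark_gset_diff mark_gset_sum)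
qed

section \<open>Classes of actual $G$-sets, the unit and zero\<close>

lemma gset_class_in_R: "finite_gset G A \<Longrightarrow> gset_class G A \<in> carrier R"
  unfolding gset_class_def by (intro gset_diff_in_R) simp_all

lemma vmark_gset_class:
  "finite_gset G A \<Longrightarrow> K \<subseteq> carrier G \<Longrightarrow> vmark (gset_class G A) K = mark A K"
  by (simp add: gset_class_def vmark_gset_diff)

text \<open>Left and right cosets of \<open>M\<close> coincide, so whether k fixes x M does not
  depend on x: \<open>K\<close> fixes all cosets or none.\<close>

lemma mark_normal_coset_gset:
  assumes "M \<lhd> G" "K \<subseteq> carrier G"
  shows "mark (coset_gset G M) K = (if K \<subseteq> M then int (card (lcosets M)) else 0)"
proof -
  interpret normal M G by fact
  have "k <# (x <# M) = x <# M \<longleftrightarrow> k \<in> M" if k: "k \<in> carrier G" and x: "x \<in> carrier G" for k x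
  proof -
    have "k <# (x <# M) = (k \<otimes> x) <# M"
      using k x subset by (simp add: lcos_m_assoc)
    also have "\<dots> = x <# M \<longleftrightarrow> k \<otimes> x \<in> x <# M"
      using l_repr_independence[of "k \<otimes> x" x M] lcos_self[of "k \<otimes> x" M] k x subgroup_axioms
      by auto
    also have "\<dots> \<longleftrightarrow> k \<otimes> x \<in> M #> x"
      using coset_eq x by simp
    also have "\<dots> \<longleftrightarrow> k \<in> M"
      using k x subset by (auto simp: r_coset_def)
    finally show ?thesis .
  qed
  then have *: "k <# C = C \<longleftrightarrow> k \<in> M" if "k \<in> carrier G" "C \<in> lcosets M" for k C
    using that by (auto simp: LCOSETS_def)
  have "fixed_points (coset_gset G M) K = (if K \<subseteq> M then lcosets M else {})"
    using * assms(2) unfolding coset_gset_eq fixed_points_gset_of by (auto simp: subset_iff)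
  then show ?thesis
    by (simp add: mark_def)
qed

lemma normal_carrier: "carrier G \<lhd> G"
  by (rule normal_invI) (auto simp: subgroup_self)

lemma card_lcosets_carrier: "card (lcosets (carrier G)) = 1"
  using l_lagrange[OF fin subgroup_self] fin one_closed by (auto simp: order_def)

lemma one_in_R [simp]: "\<one>\<^bsub>R\<^esub> \<in> carrier R"
  and vmark_one [simp]: "K \<subseteq> carrier G \<Longrightarrow> vmark \<one>\<^bsub>R\<^esub> K = 1"
proof -
  have eq: "\<one>\<^bsub>R\<^esub> = gset_class G (coset_gset G (carrier G))"
    by (simp add: burnside_ring_def)
  show "\<one>\<^bsub>R\<^esub> \<in> carrier R"
    unfolding eq by (rule gset_class_in_R) (simp add: subgroup_self)
  show "vmark \<one>\<^bsub>R\<^esub> K = 1" if "K \<subseteq> carrier G"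
    unfolding eq using that
    by (simp add: subgroup_self vmark_gset_class mark_normal_coset_gset normal_carrier card_lcosets_carrier)
qed

lemma zero_in_R [simp]: "\<zero>\<^bsub>R\<^esub> \<in> carrier R"
  and vmark_zero [simp]: "K \<subseteq> carrier G \<Longrightarrow> vmark \<zero>\<^bsub>R\<^esub> K = 0"
proof -
  have eq: "\<zero>\<^bsub>R\<^esub> = gset_class G (gset_empty :: ('a, nat) gset)"
    by (simp add: burnside_ring_def)
  show "\<zero>\<^bsub>R\<^esub> \<in> carrier R"
    unfolding eq by (rule gset_class_in_R) simp
  show "vmark \<zero>\<^bsub>R\<^esub> K = 0" if "K \<subseteq> carrier G"
    unfolding eq using that by (simp add: vmark_gset_class)
qed

text \<open>The image of the Burnside ring in its ghost ring. Closure under the ring operations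
  allows an element to be constructed by writing its marks as a polynomial in marks of concrete
  $G$-sets.\<close>

definition ghost :: "('a set \<Rightarrow> int) \<Rightarrow> bool" where
  "ghost v \<longleftrightarrow> (\<exists>P \<in> carrier R. \<forall>K \<subseteq> carrier G. vmark P K = v K)"

lemma ghost_mark: "finite_gset G S \<Longrightarrow> ghost (mark S)"
  unfolding ghost_def by (rule bexI[OF _ gset_class_in_R]) (auto simp: vmark_gset_class)

lemma ghost_add: "ghost v \<Longrightarrow> ghost w \<Longrightarrow> ghost (\<lambda>K. v K + w K)"
  unfolding ghost_def by (metis burnside_add_closed vmark_add)

lemma ghost_mult: "ghost v \<Longrightarrow> ghost w \<Longrightarrow> ghost (\<lambda>K. v K * w K)"
  unfolding ghost_def by (metis burnside_mult_closed vmark_mult)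

lemma ghost_uminus:
  assumes "ghost v"
  shows "ghost (\<lambda>K. - v K)"
proof -
  obtain P where P: "P \<in> carrier R" "\<And>K. K \<subseteq> carrier G \<Longrightarrow> vmark P K = v K"
    using assms by (auto simp: ghost_def)
  obtain A B :: "('a, nat) gset" where AB: "finite_gset G A" "finite_gset G B" "P = gset_diff G A B"
    using carrier_RE[OF P(1)] .
  show ?thesis
    unfolding ghost_def
  proof (rule bexI[OF _ gset_diff_in_R[OF AB(2,1)]], intro allI impI)
    fix K assume K: "K \<subseteq> carrier G"
    then have "mark A K - mark B K = v K" using P(2)[OF K] AB by (simp add: vmark_gset_diff)
    with K show "vmark (gset_diff G B A) K = - v K" using AB by (simp add: vmark_gset_diff)
  qed
qed

lemma ghost_of_nat: "ghost (\<lambda>K. int n)"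
proof (induction n)
  case 0
  show ?case unfolding ghost_def by (rule bexI[of _ "\<zero>\<^bsub>R\<^esub>"]) auto
next
  case (Suc n)
  have "ghost (\<lambda>K. 1)" unfolding ghost_def by (rule bexI[of _ "\<one>\<^bsub>R\<^esub>"]) auto
  from ghost_add[OF Suc this] show ?case by (simp add: add.commute)
qed

lemma ghost_const: "ghost (\<lambda>K. c)"
proof (cases "c \<ge> 0")
  case True
  then show ?thesis using ghost_of_nat[of "nat c"] by simp
next
  case False
  then show ?thesis using ghost_uminus[OF ghost_of_nat[of "nat (- c)"]] by simp
qed

lemma ghost_diff: "ghost v \<Longrightarrow> ghost w \<Longrightarrow> ghost (\<lambda>K. v K - w K)"
  using ghost_add[OF _ ghost_uminus] by fastforce

lemma ghost_sum: "(\<And>i. i \<in> I \<Longrightarrow> ghost (v i)) \<Longrightarrow> ghost (\<lambda>K. \<Sum>i\<in>I. v i K)"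
  by (induction I rule: infinite_finite_induct) (auto simp: ghost_const ghost_add)

end

section \<open>Orbit counts by kernel\<close>

text \<open>Moebius inversion reduced to uniqueness: the system is triangular for inclusion with
  nonzero diagonal \<open>w\<close>. Two weights occur: 1 for counting orbits, and the index of
  \<open>M\<close> for marks of coset spaces.\<close>

lemma upward_sums_zero_imp_zero:
  fixes d w :: "'a set \<Rightarrow> int"
  assumes fin: "finite \<N>" and w: "\<And>M. M \<in> \<N> \<Longrightarrow> w M \<noteq> 0"
    and sum0: "\<And>N. N \<in> \<N> \<Longrightarrow> (\<Sum>M | M \<in> \<N> \<and> N \<subseteq> M. d M * w M) = 0"
    and "N \<in> \<N>"
  shows "d N = 0"
  using \<open>N \<in> \<N>\<close>
proof (induction "card {M \<in> \<N>. N \<subset> M}" arbitrary: N rule: less_induct)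
  case less
  have "d M * w M = 0" if "M \<in> \<N>" "N \<subset> M" for M
  proof -
    have "card {M' \<in> \<N>. M \<subset> M'} < card {M \<in> \<N>. N \<subset> M}"
      using that fin by (intro psubset_card_mono) auto
    then show ?thesis using less.hyps that by simp
  qed
  then have "(\<Sum>M | M \<in> \<N> \<and> N \<subset> M. d M * w M) = 0"
    by (intro sum.neutral) auto
  moreover have "{M. M \<in> \<N> \<and> N \<subseteq> M} = insert N {M. M \<in> \<N> \<and> N \<subset> M}"
    using less.prems by auto
  ultimately have "d N * w N = 0"
    using sum0[OF less.prems] fin by simp
  then show ?case using w[OF less.prems] by simp
qed

text \<open>On an orbit isomorphic to G/H this is the core of H, so the kernel shows where the core
  map sends the orbit without naming a stabilizer.\<close>

definition act_kernel :: "('a, 'b) monoid_scheme \<Rightarrow> ('a, 'x) gset \<Rightarrow> 'x set \<Rightarrow> 'a set" where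
  "act_kernel G S X = {g \<in> carrier G. \<forall>x \<in> X. snd S g x = x}"

definition orbit_count :: "('a, 'b) monoid_scheme \<Rightarrow> ('a, 'x) gset \<Rightarrow> 'a set \<Rightarrow> int" where
  "orbit_count G S M = int (card {X \<in> orbits G (fst S) (snd S). act_kernel G S X = M})"

text \<open>For normal $M$ the value is independent of the representative that \<open>SOME\<close> picks: the sums
  over all $M \supseteq N$ are determined by marks, see \<open>sum_core_coeff\<close> below.\<close>
definition core_coeff ::
  "('a, 'b) monoid_scheme \<Rightarrow> (('a, nat) gset \<times> ('a, nat) gset) set \<Rightarrow> 'a set \<Rightarrow> int" where
  "core_coeff G P M = (case SOME p. p \<in> P of (A, B) \<Rightarrow> orbit_count G A M - orbit_count G B M)"

context fin_group begin

lemma finite_normal: "finite {M. M \<lhd> G}"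
  by (rule finite_subset[of _ "Pow (carrier G)"])
    (use fin in \<open>auto dest: normal_imp_subgroup subgroup.subset\<close>)

lemma normal_subset: "M \<lhd> G \<Longrightarrow> M \<subseteq> carrier G"
  by (auto dest: normal_imp_subgroup subgroup.subset)

lemma act_kernel_normal:
  assumes S: "finite_gset G S" and X: "X \<in> orbits G (fst S) (snd S)"
  shows "act_kernel G S X \<lhd> G"
proof -
  obtain x where x: "x \<in> fst S" and X: "X = orbit G (snd S) x"
    using X by (auto simp: orbits_def)
  have sub: "y \<in> fst S" if "y \<in> X" for y
    using that gset_orbit_subset[OF S x] X by auto
  have cl: "snd S g y \<in> X" if "g \<in> carrier G" "y \<in> X" for g y
    using that gset_orbit_closed[OF S x] X by auto
  show ?thesis
  proof (rule normal_invI)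
    show "subgroup (act_kernel G S X) G"
    proof (rule subgroupI)
      show "act_kernel G S X \<subseteq> carrier G" by (auto simp: act_kernel_def)
      have "\<one> \<in> act_kernel G S X"
        using sub by (auto simp: act_kernel_def gset_act_one[OF S])
      then show "act_kernel G S X \<noteq> {}" by auto
      show "inv g \<in> act_kernel G S X" if "g \<in> act_kernel G S X" for g
        using that sub gset_act_inv[OF S, of g] by (auto simp: act_kernel_def) metis
      show "g \<otimes> h \<in> act_kernel G S X" if "g \<in> act_kernel G S X" "h \<in> act_kernel G S X" for g h
        using that sub by (auto simp: act_kernel_def gset_act_mult[OF S])
    qed
    show "g \<otimes> h \<otimes> inv g \<in> act_kernel G S X" if "g \<in> carrier G" "h \<in> act_kernel G S X" for g h
      using that sub cl[of "inv g"] by (auto simp: act_kernel_def gset_act_mult[OF S] gset_act_closed[OF S] gset_act_inv'[OF S])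
  qed
qed

lemma finite_orbits: "finite_gset G S \<Longrightarrow> finite (orbits G (fst S) (snd S))"
  using finite_gset_finite[of S] by (simp add: orbits_def Setcompr_eq_image)

lemma sum_orbit_count:
  assumes S: "finite_gset G S"
  shows "(\<Sum>M | M \<lhd> G \<and> N \<subseteq> M. orbit_count G S M) =
    int (card {X \<in> orbits G (fst S) (snd S). N \<subseteq> act_kernel G S X})"
proof -
  have "{X \<in> orbits G (fst S) (snd S). N \<subseteq> act_kernel G S X} =
    (\<Union>M \<in> {M. M \<lhd> G \<and> N \<subseteq> M}. {X \<in> orbits G (fst S) (snd S). act_kernel G S X = M})"
    using act_kernel_normal[OF S] by auto
  also have "card \<dots> = (\<Sum>M | M \<lhd> G \<and> N \<subseteq> M. card {X \<in> orbits G (fst S) (snd S). act_kernel G S X = M})"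
    using finite_normal finite_orbits[OF S] by (intro card_UN_disjoint) auto
  finally show ?thesis by (simp add: orbit_count_def)
qed

text \<open>The N-fixed points are G-stable because N is normal, and their orbits are the orbits of
  \<open>S\<close> on which N acts trivially. The orbit counting lemma applies to this $G$-set; the
  points of it fixed by g are those fixed by \<open>insert g N\<close>.\<close>

lemma orbits_fixed_points:
  assumes S: "finite_gset G S" and N: "N \<lhd> G"
  shows "order G * card {X \<in> orbits G (fst S) (snd S). N \<subseteq> act_kernel G S X} =
    (\<Sum>g \<in> carrier G. card (fixed_points S (insert g N)))"
proof -
  interpret normal N G by fact
  let ?F = "gset_of (fixed_points S N) (snd S)"
  have sub: "fixed_points S N \<subseteq> fst S" by (auto simp: fixed_points_def)
  have cl: "snd S g x \<in> fixed_points S N" if g: "g \<in> carrier G" and x: "x \<in> fixed_points S N" for g x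
  proof -
    have xS: "x \<in> fst S" using x sub by auto
    have "snd S k (snd S g x) = snd S g x" if k: "k \<in> N" for k
    proof -
      \<comment> \<open>Conjugation moves k past g: k g = g (g^-1 k g), and the conjugate lies in N,
        hence fixes x.\<close>
      have k': "inv g \<otimes> k \<otimes> g \<in> N" using inv_op_closed1[OF g k] .
      have "snd S k (snd S g x) = snd S (g \<otimes> (inv g \<otimes> k \<otimes> g)) x"
        using g k xS mem_carrier[OF k] by (simp add: gset_act_mult[OF S, symmetric] m_assoc[symmetric])
      also have "\<dots> = snd S g (snd S (inv g \<otimes> k \<otimes> g) x)"
        using g k' xS mem_carrier by (simp add: gset_act_mult[OF S])
      also have "\<dots> = snd S g x"
        using k' x by (auto simp: fixed_points_def)
      finally show ?thesis .
    qed
    then show ?thesis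
      using gset_act_closed[OF S g xS] by (auto simp: fixed_points_def)
  qed
  have F: "finite_gset G ?F" by (rule finite_gset_sub[OF S sub cl])
  have orb: "orbit G (snd ?F) x = orbit G (snd S) x" if "x \<in> fixed_points S N" for x
    using that by (auto simp: orbit_def)
  have "orbits G (fst ?F) (snd ?F) = {X \<in> orbits G (fst S) (snd S). N \<subseteq> act_kernel G S X}"
  proof
    show "orbits G (fst ?F) (snd ?F) \<subseteq> {X \<in> orbits G (fst S) (snd S). N \<subseteq> act_kernel G S X}"
    proof
      fix X assume "X \<in> orbits G (fst ?F) (snd ?F)"
      then obtain x where x: "x \<in> fixed_points S N" "X = orbit G (snd S) x"
        using orb by (auto simp: orbits_def)
      then have "X \<subseteq> fixed_points S N" using cl by (auto simp: orbit_def)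
      then have "N \<subseteq> act_kernel G S X"
        using subset by (auto simp: act_kernel_def fixed_points_def)
      then show "X \<in> {X \<in> orbits G (fst S) (snd S). N \<subseteq> act_kernel G S X}"
        using x sub by (auto simp: orbits_def)
    qed
    show "{X \<in> orbits G (fst S) (snd S). N \<subseteq> act_kernel G S X} \<subseteq> orbits G (fst ?F) (snd ?F)"
    proof
      fix X assume "X \<in> {X \<in> orbits G (fst S) (snd S). N \<subseteq> act_kernel G S X}"
      then obtain x where x: "x \<in> fst S" "X = orbit G (snd S) x" "N \<subseteq> act_kernel G S X"
        by (auto simp: orbits_def)
      then have "x \<in> fixed_points S N"
        using gset_orbit_refl[OF S x(1)] by (auto simp: fixed_points_def act_kernel_def)
      then show "X \<in> orbits G (fst ?F) (snd ?F)"
        using orb[of x] x by (auto simp: orbits_def)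
    qed
  qed
  moreover have "invariants (fst ?F) (snd ?F) g = fixed_points S (insert g N)" for g
    by (auto simp: invariants_def fixed_points_def)
  moreover have "card (orbits G (fst ?F) (snd ?F)) * order G =
      (\<Sum>g \<in> carrier G. card (invariants (fst ?F) (snd ?F) g))"
    by (rule group_action.burnside) (use F fin in \<open>auto simp: finite_gset_def\<close>)
  ultimately show ?thesis by (simp add: mult.commute)
qed

lemma sum_orbit_count_mark:
  assumes "finite_gset G S" "N \<lhd> G"
  shows "int (order G) * (\<Sum>M | M \<lhd> G \<and> N \<subseteq> M. orbit_count G S M) =
    (\<Sum>g \<in> carrier G. mark S (insert g N))"
  using arg_cong[OF orbits_fixed_points[OF assms], of int]
  by (simp add: sum_orbit_count[OF assms(1)] mark_def)

lemma sum_core_coeff: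
  assumes P: "P \<in> carrier R" and N: "N \<lhd> G"
  shows "int (order G) * (\<Sum>M | M \<lhd> G \<and> N \<subseteq> M. core_coeff G P M) =
    (\<Sum>g \<in> carrier G. vmark P (insert g N))"
proof -
  obtain A B where AB: "(SOME p. p \<in> P) = (A, B)" by (rule prod.exhaust)
  obtain C D where "(C, D) \<in> P" using carrier_RE[OF P] nat_gset_diff by metis
  then have mem: "(A, B) \<in> P" using someI[of "\<lambda>p. p \<in> P"] AB by auto
  have "vmark P K = mark A K - mark B K" for K by (simp add: vmark_def AB)
  moreover have "core_coeff G P M = orbit_count G A M - orbit_count G B M" for M
    by (simp add: core_coeff_def AB)
  ultimately show ?thesis
    using sum_orbit_count_mark[OF carrier_R_mem(1)[OF P mem] N]
      sum_orbit_count_mark[OF carrier_R_mem(2)[OF P mem] N]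
    by (simp add: sum_subtractf right_diff_distrib)
qed

lemma order_pos: "order G > 0"
  using fin by (simp add: order_gt_0_iff_finite)

lemma upward_sums_eqI:
  assumes "\<And>N. N \<lhd> G \<Longrightarrow> (\<Sum>M | M \<lhd> G \<and> N \<subseteq> M. c M) = (\<Sum>M | M \<lhd> G \<and> N \<subseteq> M. c' M :: int)"
    and "M \<lhd> G"
  shows "c M = c' M"
proof -
  have "c M - c' M = 0"
    by (rule upward_sums_zero_imp_zero[OF finite_normal, of "\<lambda>_. 1" "\<lambda>M. c M - c' M"])
      (use assms in \<open>simp_all add: sum_subtractf\<close>)
  then show ?thesis by simp
qed

text \<open>The representative chosen for the sum is unrelated to those chosen for the summands.
  Additivity is visible only in the upward sums, which are expressed by marks, and is carried back
  by inversion.\<close>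

lemma core_coeff_add:
  assumes "P \<in> carrier R" "Q \<in> carrier R" "M \<lhd> G"
  shows "core_coeff G (P \<oplus>\<^bsub>R\<^esub> Q) M = core_coeff G P M + core_coeff G Q M"
proof (rule upward_sums_eqI[OF _ assms(3)])
  fix N assume N: "N \<lhd> G"
  have "int (order G) * (\<Sum>M | M \<lhd> G \<and> N \<subseteq> M. core_coeff G (P \<oplus>\<^bsub>R\<^esub> Q) M) =
      int (order G) * (\<Sum>M | M \<lhd> G \<and> N \<subseteq> M. core_coeff G P M + core_coeff G Q M)"
    using sum_core_coeff[OF assms(1) N] sum_core_coeff[OF assms(2) N]
      sum_core_coeff[OF burnside_add_closed[OF assms(1,2)] N] normal_subset[OF N] assms(1,2)
    by (simp add: sum.distrib distrib_left vmark_add)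
  then show "(\<Sum>M | M \<lhd> G \<and> N \<subseteq> M. core_coeff G (P \<oplus>\<^bsub>R\<^esub> Q) M) =
      (\<Sum>M | M \<lhd> G \<and> N \<subseteq> M. core_coeff G P M + core_coeff G Q M)"
    using order_pos by simp
qed

text \<open>The chosen representative of the class may be a formal difference quite unlike
  \<open>S\<close>; its marks agree with those of \<open>S\<close>, so the inverted sums do
  too.\<close>

lemma core_coeff_class:
  assumes S: "finite_gset G S" and M: "M \<lhd> G"
  shows "core_coeff G (gset_class G S) M = orbit_count G S M"
proof (rule upward_sums_eqI[OF _ M])
  fix N assume N: "N \<lhd> G"
  have "int (order G) * (\<Sum>M | M \<lhd> G \<and> N \<subseteq> M. core_coeff G (gset_class G S) M) =
      int (order G) * (\<Sum>M | M \<lhd> G \<and> N \<subseteq> M. orbit_count G S M)"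
    using sum_core_coeff[OF gset_class_in_R[OF S] N] sum_orbit_count_mark[OF S N] normal_subset[OF N]
    by (simp add: vmark_gset_class[OF S])
  then show "(\<Sum>M | M \<lhd> G \<and> N \<subseteq> M. core_coeff G (gset_class G S) M) =
      (\<Sum>M | M \<lhd> G \<and> N \<subseteq> M. orbit_count G S M)"
    using order_pos by simp
qed

text \<open>An element fixes x H iff it lies in x H x^-1; intersecting over all x gives the
  core.\<close>

lemma act_kernel_coset_gset:
  assumes H: "subgroup H G"
  shows "act_kernel G (coset_gset G H) (lcosets H) = normal_core G H"
proof -
  interpret subgroup H G by fact
  have 1: "k <# (x <# H) = x <# H \<longleftrightarrow> inv x \<otimes> k \<otimes> x \<in> H"
    if k: "k \<in> carrier G" and x: "x \<in> carrier G" for k x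
  proof -
    have "k <# (x <# H) = (k \<otimes> x) <# H"
      using k x subset by (simp add: lcos_m_assoc)
    also have "\<dots> = x <# H \<longleftrightarrow> k \<otimes> x \<in> x <# H"
      using l_repr_independence[of "k \<otimes> x" x H] lcos_self[of "k \<otimes> x" H] k x H
      by auto
    also have "\<dots> \<longleftrightarrow> inv x \<otimes> (k \<otimes> x) \<in> H"
      using k x lcos_module_imp[OF is_group x] lcos_module_rev[OF is_group x] by auto
    finally show ?thesis using k x by (simp add: m_assoc)
  qed
  have 2: "k \<in> x <# H #> inv x \<longleftrightarrow> inv x \<otimes> k \<otimes> x \<in> H"
    if k: "k \<in> carrier G" and x: "x \<in> carrier G" for k x
  proof -
    have cancel: "inv x \<otimes> (x \<otimes> a) = a" "x \<otimes> (inv x \<otimes> a) = a" if "a \<in> carrier G" for a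
      using that x by (simp_all add: m_assoc[symmetric])
    show ?thesis
    proof
      assume "k \<in> x <# H #> inv x"
      then obtain h where h: "h \<in> H" "k = x \<otimes> h \<otimes> inv x"
        by (auto simp: l_coset_def r_coset_def)
      then show "inv x \<otimes> k \<otimes> x \<in> H" using x mem_carrier[OF h(1)] by (simp add: m_assoc cancel)
    next
      assume "inv x \<otimes> k \<otimes> x \<in> H"
      moreover have "k = x \<otimes> (inv x \<otimes> k \<otimes> x) \<otimes> inv x"
        using k x by (simp add: m_assoc cancel)
      ultimately show "k \<in> x <# H #> inv x" unfolding l_coset_def r_coset_def by blast
    qed
  qed
  have "\<one> <# H #> inv \<one> \<subseteq> carrier G"
    using subset by (auto simp: l_coset_def r_coset_def)
  then have "normal_core G H \<subseteq> carrier G"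
    unfolding normal_core_def by blast
  moreover have "k \<in> normal_core G H \<longleftrightarrow> k \<in> act_kernel G (coset_gset G H) (lcosets H)"
    if k: "k \<in> carrier G" for k
  proof -
    have "k \<in> act_kernel G (coset_gset G H) (lcosets H) \<longleftrightarrow>
        (\<forall>x \<in> carrier G. k <# (x <# H) = x <# H)"
      using k by (auto simp: act_kernel_def coset_gset_eq LCOSETS_def)
    then show ?thesis
      using k by (simp add: 1 2 normal_core_def)
  qed
  moreover have "act_kernel G (coset_gset G H) (lcosets H) \<subseteq> carrier G"
    by (auto simp: act_kernel_def)
  ultimately show ?thesis by blast
qed

lemma orbits_coset_gset:
  assumes H: "subgroup H G"
  shows "orbits G (fst (coset_gset G H)) (snd (coset_gset G H)) = {lcosets H}"
proof -
  interpret subgroup H G by fact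
  have "orbit G (snd (coset_gset G H)) (x <# H) = lcosets H" if x: "x \<in> carrier G" for x
  proof -
    have "orbit G (snd (coset_gset G H)) (x <# H) = (\<lambda>g. g <# (x <# H)) ` carrier G"
    proof -
      have "x <# H \<in> lcosets H" using x by (auto simp: LCOSETS_def)
      then show ?thesis by (auto simp: orbit_def coset_gset_eq)
    qed
    also have "\<dots> = (\<lambda>g. (g \<otimes> x) <# H) ` carrier G"
      using x subset by (intro image_cong) (simp_all add: lcos_m_assoc)
    also have "\<dots> = (\<lambda>g. g <# H) ` ((\<lambda>g. g \<otimes> x) ` carrier G)"
      by (simp add: image_image)
    also have "(\<lambda>g. g \<otimes> x) ` carrier G = carrier G"
    proof
      show "carrier G \<subseteq> (\<lambda>g. g \<otimes> x) ` carrier G"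
      proof
        fix y assume "y \<in> carrier G"
        then show "y \<in> (\<lambda>g. g \<otimes> x) ` carrier G"
          using x by (intro image_eqI[of _ _ "y \<otimes> inv x"]) (simp_all add: m_assoc)
      qed
    qed (use x in auto)
    also have "(\<lambda>g. g <# H) ` carrier G = lcosets H"
      by (auto simp: LCOSETS_def)
    finally show ?thesis .
  qed
  then have "orbit G (snd (coset_gset G H)) ` (lcosets H) = {lcosets H}"
    using one_closed by (auto simp: LCOSETS_def)
  then show ?thesis
    unfolding orbits_def by (simp add: coset_gset_eq Setcompr_eq_image)
qed

lemma normal_core_normal:
  assumes "subgroup H G"
  shows "normal_core G H \<lhd> G"
  using act_kernel_normal[of "coset_gset G H" "lcosets H"] assms
  by (simp add: orbits_coset_gset act_kernel_coset_gset)

lemma orbit_count_coset_gset: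
  assumes "subgroup H G"
  shows "orbit_count G (coset_gset G H) M = (if M = normal_core G H then 1 else 0)"
proof -
  have "{X \<in> {lcosets H}. act_kernel G (coset_gset G H) X = M} =
      (if M = normal_core G H then {lcosets H} else {})"
    using assms by (auto simp: act_kernel_coset_gset)
  then show ?thesis
    using assms by (simp add: orbit_count_def orbits_coset_gset)
qed

section \<open>The core map\<close>

text \<open>Marks of the expected value of the core map, in which every orbit with kernel
  \<open>M\<close> is replaced by [G/M].\<close>

definition core_marks :: "(('a, nat) gset \<times> ('a, nat) gset) set \<Rightarrow> 'a set \<Rightarrow> int" where
  "core_marks P K = (\<Sum>M | M \<lhd> G. core_coeff G P M * mark (coset_gset G M) K)"

lemma ghost_core_marks: "ghost (core_marks P)"
  unfolding core_marks_def
  by (intro ghost_sum ghost_mult ghost_const ghost_mark) (auto dest: normal_imp_subgroup)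

text \<open>The choice is unique because marks determine ring elements; the restriction supplies the
  extensionality demanded by \<open>core_map\<close>.\<close>

definition core_fun :: "(('a, nat) gset \<times> ('a, nat) gset) set \<Rightarrow> (('a, nat) gset \<times> ('a, nat) gset) set" where
  "core_fun = (\<lambda>P \<in> carrier R. SOME Q. Q \<in> carrier R \<and> (\<forall>K \<subseteq> carrier G. vmark Q K = core_marks P K))"

lemma
  assumes P: "P \<in> carrier R"
  shows core_fun_closed: "core_fun P \<in> carrier R"
    and vmark_core_fun: "\<And>K. K \<subseteq> carrier G \<Longrightarrow> vmark (core_fun P) K = core_marks P K"
proof -
  have "\<exists>Q. Q \<in> carrier R \<and> (\<forall>K \<subseteq> carrier G. vmark Q K = core_marks P K)"
    using ghost_core_marks[of P] by (auto simp: ghost_def)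
  from someI_ex[OF this] P show "core_fun P \<in> carrier R"
    "\<And>K. K \<subseteq> carrier G \<Longrightarrow> vmark (core_fun P) K = core_marks P K"
    by (auto simp: core_fun_def)
qed

lemma core_fun_hom: "core_fun \<in> hom (add_monoid R) (add_monoid R)"
proof (rule homI; simp)
  fix P Q assume PQ: "P \<in> carrier R" "Q \<in> carrier R"
  show "core_fun P \<in> carrier R" by (rule core_fun_closed[OF PQ(1)])
  show "core_fun (P \<oplus>\<^bsub>R\<^esub> Q) = core_fun P \<oplus>\<^bsub>R\<^esub> core_fun Q"
  proof (rule burnside_ring_eqI)
    fix K assume "K \<subseteq> carrier G"
    then show "vmark (core_fun (P \<oplus>\<^bsub>R\<^esub> Q)) K = vmark (core_fun P \<oplus>\<^bsub>R\<^esub> core_fun Q) K"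
      using PQ by (simp add: vmark_core_fun burnside_add_closed vmark_add core_fun_closed
        core_marks_def core_coeff_add distrib_right sum.distrib)
  qed (use PQ in \<open>simp_all add: core_fun_closed burnside_add_closed\<close>)
qed

lemma core_fun_coset:
  assumes H: "subgroup H G"
  shows "core_fun (gset_class G (coset_gset G H)) = gset_class G (coset_gset G (normal_core G H))"
proof -
  have fH: "finite_gset G (coset_gset G H)" using H by simp
  have fC: "finite_gset G (coset_gset G (normal_core G H))"
    using normal_core_normal[OF H] by (simp add: normal_imp_subgroup)
  show ?thesis
  proof (rule burnside_ring_eqI)
    fix K assume K: "K \<subseteq> carrier G"
    have "core_marks (gset_class G (coset_gset G H)) K =
        (\<Sum>M | M \<lhd> G. if M = normal_core G H then mark (coset_gset G M) K else 0)"
      unfolding core_marks_def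
      by (intro sum.cong refl) (simp add: core_coeff_class[OF fH] orbit_count_coset_gset[OF H])
    also have "\<dots> = mark (coset_gset G (normal_core G H)) K"
      using finite_normal normal_core_normal[OF H] by simp
    finally show "vmark (core_fun (gset_class G (coset_gset G H))) K =
        vmark (gset_class G (coset_gset G (normal_core G H))) K"
      using K by (simp add: vmark_core_fun gset_class_in_R[OF fH] vmark_gset_class[OF fC])
  qed (simp_all add: core_fun_closed gset_class_in_R fH fC)
qed

text \<open>Transitive $G$-sets generate additively: an orbit is isomorphic to a coset space of a
  stabilizer and can be split off, leaving a smaller $G$-set. This generation is the half of the
  basis property that uniqueness of the core map rests on.\<close>

lemma additive_maps_eq_on_class:
  assumes f: "f \<in> hom (add_monoid R) (add_monoid R)" and f': "f' \<in> hom (add_monoid R) (add_monoid R)"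
    and eq: "\<And>H. subgroup H G \<Longrightarrow> f (gset_class G (coset_gset G H)) = f' (gset_class G (coset_gset G H))"
    and S: "finite_gset G S" and K: "K \<subseteq> carrier G"
  shows "vmark (f (gset_class G S)) K = vmark (f' (gset_class G S)) K"
  using S
proof (induction "card (fst S)" arbitrary: S rule: less_induct)
  case less
  note S = less.prems
  have add: "vmark (h (P \<oplus>\<^bsub>R\<^esub> Q)) K = vmark (h P) K + vmark (h Q) K"
    if "h \<in> hom (add_monoid R) (add_monoid R)" "P \<in> carrier R" "Q \<in> carrier R" for h P Q
  proof -
    have "h P \<in> carrier R" "h Q \<in> carrier R" "h (P \<oplus>\<^bsub>R\<^esub> Q) = h P \<oplus>\<^bsub>R\<^esub> h Q"
      using that by (auto simp: hom_def)
    then show ?thesis using K by (simp add: vmark_add)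
  qed
  show ?case
  proof (cases "fst S = {}")
    case True
    then have "mark S L = 0" for L by (simp add: mark_def fixed_points_def)
    \<comment> \<open>Membership in \<open>hom\<close> says nothing about zero. The class of the
      empty $G$-set equals its own double, so the mark v of its image satisfies v = v + v.\<close>
    then have "gset_class G S = gset_class G S \<oplus>\<^bsub>R\<^esub> gset_class G S"
      using S by (intro burnside_ring_eqI) (simp_all add: gset_class_in_R burnside_add_closed vmark_add vmark_gset_class)
    then show ?thesis
      using add[OF f, of "gset_class G S" "gset_class G S"] add[OF f', of "gset_class G S" "gset_class G S"]
        gset_class_in_R[OF S] by simp
  next
    case False
    then obtain x where x: "x \<in> fst S" by auto
    let ?O = "gset_of (orbit G (snd S) x) (snd S)"
    let ?S = "gset_of (fst S - orbit G (snd S) x) (snd S)"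
    note sub = gset_orbit_subset[OF S x] and cl = gset_orbit_closed[OF S x]
    have fO: "finite_gset G ?O"
      by (rule finite_gset_sub[OF S sub cl])
    have fS: "finite_gset G ?S"
      by (rule finite_gset_sub[OF S]) (use gset_complement_closed[OF S sub cl] in auto)
    let ?H = "stabilizer G (snd S) x"
    have H: "subgroup ?H G" by (rule gset_stabilizer_subgroup[OF S x])
    let ?C = "coset_gset G ?H"
    have fC: "finite_gset G ?C" using H by simp
    have HC: "?H \<in> fst ?C"
      using lcos_mult_one[OF subgroup.subset[OF H]] by (force simp: coset_gset_eq LCOSETS_def)
    \<comment> \<open>The base coset has stabilizer H, the same as x, and its orbit is the whole
      coset space; hence the orbit of x is isomorphic to G/H.\<close>
    have "stabilizer G (snd ?C) ?H = ?H"
    proof -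
      have "g <# ?H = ?H \<longleftrightarrow> g \<in> ?H" if "g \<in> carrier G" for g
        using that lcos_self[OF that H] l_repr_independence[OF _ one_closed H, of g]
          lcos_mult_one[OF subgroup.subset[OF H]] by auto
      then show ?thesis
        using HC subgroup.subset[OF H] unfolding stabilizer_def[of _ "snd ?C"] by (auto simp: coset_gset_eq)
    qed
    then have iso: "gset_iso G ?O (gset_of (orbit G (snd ?C) ?H) (snd ?C))"
      using gset_iso_orbits[OF S fC x HC] by simp
    have "orbit G (snd ?C) ?H = fst ?C"
      using orbits_coset_gset[OF H] HC by (auto simp: orbits_def coset_gset_eq)
    then have "mark ?O L = mark ?C L" if "L \<subseteq> carrier G" for L
      using mark_gset_iso[OF iso that fO] by (simp add: mark_def fixed_points_gset_of fixed_points_def cong: conj_cong)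
    then have "gset_class G S = gset_class G ?C \<oplus>\<^bsub>R\<^esub> gset_class G ?S"
      using S fC fS mark_split[OF S sub]
      by (intro burnside_ring_eqI) (simp_all add: gset_class_in_R burnside_add_closed vmark_add vmark_gset_class)
    moreover have "vmark (f (gset_class G ?S)) K = vmark (f' (gset_class G ?S)) K"
    proof (rule less.hyps[OF _ fS])
      show "card (fst ?S) < card (fst S)"
        using finite_gset_finite[OF S] gset_orbit_refl[OF S x] x by (auto intro!: psubset_card_mono)
    qed
    ultimately show ?thesis
      using add[OF f, of "gset_class G ?C" "gset_class G ?S"] add[OF f', of "gset_class G ?C" "gset_class G ?S"]
        gset_class_in_R[OF fC] gset_class_in_R[OF fS] eq[OF H] by simp
  qed
qed

lemma additive_maps_eq:
  assumes f: "f \<in> hom (add_monoid R) (add_monoid R)" and f': "f' \<in> hom (add_monoid R) (add_monoid R)"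
    and eq: "\<And>H. subgroup H G \<Longrightarrow> f (gset_class G (coset_gset G H)) = f' (gset_class G (coset_gset G H))"
    and P: "P \<in> carrier R"
  shows "f P = f' P"
proof (rule burnside_ring_eqI)
  show "f P \<in> carrier R" "f' P \<in> carrier R" using f f' P by (auto simp: hom_def)
  fix K assume K: "K \<subseteq> carrier G"
  obtain A B :: "('a, nat) gset" where AB: "finite_gset G A" "finite_gset G B" "P = gset_diff G A B"
    using carrier_RE[OF P] .
  note R = gset_class_in_R[OF AB(1)] gset_class_in_R[OF AB(2)]
  \<comment> \<open>The relation P = [A] - [B] is used without subtraction, because the maps are
    only known to respect sums.\<close>
  have "P \<oplus>\<^bsub>R\<^esub> gset_class G B = gset_class G A"
    using P AB R
    by (intro burnside_ring_eqI) (simp_all add: burnside_add_closed vmark_add vmark_gset_class vmark_gset_diff)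
  then have "vmark (h P) K + vmark (h (gset_class G B)) K = vmark (h (gset_class G A)) K"
    if "h \<in> hom (add_monoid R) (add_monoid R)" for h
  proof -
    have "h P \<in> carrier R" "h (gset_class G B) \<in> carrier R"
      "h (P \<oplus>\<^bsub>R\<^esub> gset_class G B) = h P \<oplus>\<^bsub>R\<^esub> h (gset_class G B)"
      using that P R by (auto simp: hom_def)
    then show ?thesis
      using K \<open>P \<oplus>\<^bsub>R\<^esub> gset_class G B = gset_class G A\<close> by (metis vmark_add)
  qed
  from this[OF f] this[OF f'] show "vmark (f P) K = vmark (f' P) K"
    using additive_maps_eq_on_class[OF f f' eq AB(1) K] additive_maps_eq_on_class[OF f f' eq AB(2) K]
    by simp
qed

lemma core_map_eq: "core_map G = core_fun"
  unfolding core_map_def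
proof (rule the_equality)
  show *: "core_fun \<in> hom (add_monoid R) (add_monoid R) \<and> core_fun \<in> extensional (carrier R) \<and>
    (\<forall>H. subgroup H G \<longrightarrow>
      core_fun (gset_class G (coset_gset G H)) = gset_class G (coset_gset G (normal_core G H)))"
    using core_fun_hom core_fun_coset by (auto simp: core_fun_def)
  fix f assume f: "f \<in> hom (add_monoid R) (add_monoid R) \<and> f \<in> extensional (carrier R) \<and>
    (\<forall>H. subgroup H G \<longrightarrow>
      f (gset_class G (coset_gset G H)) = gset_class G (coset_gset G (normal_core G H)))"
  show "f = core_fun"
  proof (rule extensionalityI[of _ "carrier R"])
    fix P assume "P \<in> carrier R"
    then show "f P = core_fun P"
      by (rule additive_maps_eq[rotated -1]) (use f * in simp_all)
  qed (use f * in simp_all)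
qed

text \<open>The orbit count of $u^N$ is the average over $g$ of the marks of $u$ at $N\langle g\rangle$.
  For a unit these marks are at most $1$, so the average is $1$ only if all of them are.\<close>
lemma core_map_eq_one_iff:
  assumes u: "u \<in> carrier R" and le: "\<And>K. K \<subseteq> carrier G \<Longrightarrow> vmark u K \<le> 1"
  shows "core_map G u = \<one>\<^bsub>R\<^esub> \<longleftrightarrow> (\<forall>N g. N \<lhd> G \<longrightarrow> g \<in> carrier G \<longrightarrow> vmark u (insert g N) = 1)"
proof -
  \<comment> \<open>The coefficients of the ring unit [G/G].\<close>
  let ?\<delta> = "\<lambda>M. if M = carrier G then 1 else 0 :: int"
  have \<delta>: "(\<Sum>M | M \<lhd> G \<and> N \<subseteq> M. ?\<delta> M * w M) = w (carrier G)" if "N \<lhd> G" for N and w :: "'a set \<Rightarrow> int"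
  proof -
    have "finite {M. M \<lhd> G \<and> N \<subseteq> M}" by (rule finite_subset[OF _ finite_normal]) auto
    then show ?thesis
      using that normal_carrier normal_subset by (simp add: if_distrib[of "\<lambda>x. x * _"] cong: if_cong)
  qed
  have marks: "core_marks u K = (\<Sum>M | M \<lhd> G \<and> K \<subseteq> M. core_coeff G u M * int (card (lcosets M)))"
    if "K \<subseteq> carrier G" for K
    unfolding core_marks_def using that finite_normal
    by (intro sum.mono_neutral_cong_right) (auto simp: mark_normal_coset_gset)
  have index: "card (lcosets M) \<noteq> 0" if "M \<lhd> G" for M
    using l_lagrange[OF fin normal_imp_subgroup[OF that]] order_pos
    by (metis mult_zero_left less_irrefl)
  have coeff: "core_map G u = \<one>\<^bsub>R\<^esub> \<longleftrightarrow> (\<forall>M. M \<lhd> G \<longrightarrow> core_coeff G u M = ?\<delta> M)"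
  proof
    assume one: "core_map G u = \<one>\<^bsub>R\<^esub>"
    show "\<forall>M. M \<lhd> G \<longrightarrow> core_coeff G u M = ?\<delta> M"
    proof (intro allI impI)
      fix M assume M: "M \<lhd> G"
      \<comment> \<open>Marks at normal subgroups are enough here: at N the mark of [G/M] is the
        index of M if M contains N and 0 otherwise, so the marks of the core map are upward sums
        weighted by the index.\<close>
      have "core_coeff G u M - ?\<delta> M = 0"
      proof (rule upward_sums_zero_imp_zero[OF finite_normal, of "\<lambda>M. int (card (lcosets M))" "\<lambda>M. core_coeff G u M - ?\<delta> M"])
        fix N assume "N \<in> {M. M \<lhd> G}"
        then have N: "N \<lhd> G" by simp
        have "(\<Sum>M | M \<lhd> G \<and> N \<subseteq> M. core_coeff G u M * int (card (lcosets M))) = 1"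
          using marks[OF normal_subset[OF N]] vmark_core_fun[OF u normal_subset[OF N]] one
            normal_subset[OF N] by (simp add: core_map_eq)
        then show "(\<Sum>M | M \<in> {M. M \<lhd> G} \<and> N \<subseteq> M. (core_coeff G u M - ?\<delta> M) * int (card (lcosets M))) = 0"
          using \<delta>[OF N, of "\<lambda>M. int (card (lcosets M))"]
          by (simp add: left_diff_distrib sum_subtractf card_lcosets_carrier)
      qed (use M index in simp_all)
      then show "core_coeff G u M = ?\<delta> M" by simp
    qed
  next
    assume coeff: "\<forall>M. M \<lhd> G \<longrightarrow> core_coeff G u M = ?\<delta> M"
    show "core_map G u = \<one>\<^bsub>R\<^esub>"
      unfolding core_map_eq
    proof (rule burnside_ring_eqI)
      fix K assume K: "K \<subseteq> carrier G"
      have "core_marks u K = (\<Sum>M | M \<lhd> G. ?\<delta> M * mark (coset_gset G M) K)"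
        unfolding core_marks_def using coeff by (intro sum.cong) auto
      also have "\<dots> = mark (coset_gset G (carrier G)) K"
        using finite_normal normal_carrier by (simp add: if_distrib[of "\<lambda>x. x * _"] cong: if_cong)
      also have "\<dots> = 1"
        using K by (simp add: mark_normal_coset_gset normal_carrier card_lcosets_carrier)
      finally show "vmark (core_fun u) K = vmark \<one>\<^bsub>R\<^esub> K"
        using u K by (simp add: vmark_core_fun)
    qed (use u in \<open>simp_all add: core_fun_closed\<close>)
  qed
  \<comment> \<open>The same inversion with weight 1 turns the coefficients into the orbit numbers
    of u^N.\<close>
  also have "\<dots> \<longleftrightarrow> (\<forall>N. N \<lhd> G \<longrightarrow> (\<Sum>M | M \<lhd> G \<and> N \<subseteq> M. core_coeff G u M) = 1)"
  proof
    assume c: "\<forall>M. M \<lhd> G \<longrightarrow> core_coeff G u M = ?\<delta> M"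
    show "\<forall>N. N \<lhd> G \<longrightarrow> (\<Sum>M | M \<lhd> G \<and> N \<subseteq> M. core_coeff G u M) = 1"
      using \<delta>[of _ "\<lambda>_. 1"] c by simp
  next
    assume c: "\<forall>N. N \<lhd> G \<longrightarrow> (\<Sum>M | M \<lhd> G \<and> N \<subseteq> M. core_coeff G u M) = 1"
    show "\<forall>M. M \<lhd> G \<longrightarrow> core_coeff G u M = ?\<delta> M"
    proof (intro allI impI)
      fix M assume "M \<lhd> G"
      then show "core_coeff G u M = ?\<delta> M"
      proof (rule upward_sums_eqI[rotated])
        fix N assume "N \<lhd> G"
        then show "(\<Sum>M | M \<lhd> G \<and> N \<subseteq> M. core_coeff G u M) = (\<Sum>M | M \<lhd> G \<and> N \<subseteq> M. ?\<delta> M)"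
          using \<delta>[of N "\<lambda>_. 1"] c by simp
      qed
    qed
  qed
  also have "\<dots> \<longleftrightarrow> (\<forall>N. N \<lhd> G \<longrightarrow> (\<forall>g \<in> carrier G. vmark u (insert g N) = 1))"
  proof -
    have "(\<Sum>M | M \<lhd> G \<and> N \<subseteq> M. core_coeff G u M) = 1 \<longleftrightarrow> (\<forall>g \<in> carrier G. vmark u (insert g N) = 1)"
      if N: "N \<lhd> G" for N
    proof -
      have "(\<Sum>M | M \<lhd> G \<and> N \<subseteq> M. core_coeff G u M) = 1 \<longleftrightarrow>
          int (order G) * (\<Sum>M | M \<lhd> G \<and> N \<subseteq> M. core_coeff G u M) = int (order G) * 1"
        using order_pos by (subst mult_cancel_left) simp
      also have "\<dots> \<longleftrightarrow> (\<Sum>g \<in> carrier G. 1 - vmark u (insert g N)) = 0"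
        unfolding sum_core_coeff[OF u N] by (auto simp: sum_subtractf order_def)
      also have "\<dots> \<longleftrightarrow> (\<forall>g \<in> carrier G. 1 - vmark u (insert g N) = 0)"
        using fin le normal_subset[OF N] by (intro sum_nonneg_eq_0_iff) auto
      finally show ?thesis by (simp add: eq_commute[of "1 :: int"])
    qed
    then show ?thesis by auto
  qed
  finally show ?thesis by blast
qed

section \<open>Units as sign-valued mark functions\<close>

lemma Units_burnside_marks:
  assumes "u \<in> Units R" "K \<subseteq> carrier G"
  shows "vmark u K = 1 \<or> vmark u K = -1"
proof -
  obtain v where v: "v \<in> carrier R" "u \<in> carrier R" "u \<otimes>\<^bsub>R\<^esub> v = \<one>\<^bsub>R\<^esub>"
    using assms(1) by (auto simp: Units_def)
  then have "vmark u K * vmark v K = 1"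
    using vmark_mult[OF v(2,1) assms(2)] assms(2) by simp
  then show ?thesis by (auto simp: zmult_eq_1_iff)
qed

lemma burnside_square_eq_one:
  assumes "u \<in> carrier R" "\<And>K. K \<subseteq> carrier G \<Longrightarrow> vmark u K = 1 \<or> vmark u K = -1"
  shows "u \<otimes>\<^bsub>R\<^esub> u = \<one>\<^bsub>R\<^esub>"
proof (rule burnside_ring_eqI)
  fix K assume "K \<subseteq> carrier G"
  then show "vmark (u \<otimes>\<^bsub>R\<^esub> u) K = vmark \<one>\<^bsub>R\<^esub> K"
    using assms(2)[of K] assms(1) by (auto simp: vmark_mult)
qed (simp_all add: assms(1) burnside_mult_closed)

text \<open>A ring element whose marks are all 1 or -1 squares to 1, so it is its own inverse and
  automatically a unit. Membership becomes a condition on marks alone.\<close>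

lemma carrier_core_trivial_units:
  "carrier (core_trivial_units G) = {u \<in> carrier R.
     (\<forall>K \<subseteq> carrier G. vmark u K = 1 \<or> vmark u K = -1) \<and>
     (\<forall>N g. N \<lhd> G \<longrightarrow> g \<in> carrier G \<longrightarrow> vmark u (insert g N) = 1)}"
proof -
  have units: "u \<in> Units R \<longleftrightarrow> u \<in> carrier R \<and> (\<forall>K \<subseteq> carrier G. vmark u K = 1 \<or> vmark u K = -1)" for u
  proof
    assume "u \<in> Units R"
    then show "u \<in> carrier R \<and> (\<forall>K \<subseteq> carrier G. vmark u K = 1 \<or> vmark u K = -1)"
      using Units_burnside_marks by (simp add: Units_def)
  next
    assume "u \<in> carrier R \<and> (\<forall>K \<subseteq> carrier G. vmark u K = 1 \<or> vmark u K = -1)"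
    then have "u \<in> carrier R" "u \<otimes>\<^bsub>R\<^esub> u = \<one>\<^bsub>R\<^esub>"
      using burnside_square_eq_one by simp_all
    then show "u \<in> Units R" unfolding Units_def by blast
  qed
  have core: "core_map G u = \<one>\<^bsub>R\<^esub> \<longleftrightarrow> (\<forall>N g. N \<lhd> G \<longrightarrow> g \<in> carrier G \<longrightarrow> vmark u (insert g N) = 1)"
    if "u \<in> carrier R" "\<forall>K \<subseteq> carrier G. vmark u K = 1 \<or> vmark u K = -1" for u
  proof (rule core_map_eq_one_iff[OF that(1)])
    fix K assume "K \<subseteq> carrier G"
    then have "vmark u K = 1 \<or> vmark u K = -1" using that(2) by blast
    then show "vmark u K \<le> 1" by auto
  qed
  have "carrier (core_trivial_units G) = {u \<in> Units R. core_map G u = \<one>\<^bsub>R\<^esub>}"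
    by (simp add: core_trivial_units_def)
  also have "\<dots> = {u \<in> carrier R. (\<forall>K \<subseteq> carrier G. vmark u K = 1 \<or> vmark u K = -1) \<and>
     (\<forall>N g. N \<lhd> G \<longrightarrow> g \<in> carrier G \<longrightarrow> vmark u (insert g N) = 1)}"
    by (rule Collect_cong) (use units core in blast)
  finally show ?thesis .
qed

end

section \<open>The rank of the group of core-trivial units\<close>

text \<open>Exponent 2 makes powers compatible with addition modulo 2: the scalar law for 1 + 1 = 0
  reads a a = 1. It also makes every element its own negative.\<close>

lemma vectorspace_F2_space:
  assumes A: "comm_group A" and exp2: "\<And>a. a \<in> carrier A \<Longrightarrow> a \<otimes>\<^bsub>A\<^esub> a = \<one>\<^bsub>A\<^esub>"
  shows "vectorspace (residue_ring 2) (F2_space A)"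
proof -
  interpret A: comm_group A by fact
  interpret F: residues_prime 2 "residue_ring 2" by unfold_locales simp_all
  have F_simps: "carrier (residue_ring 2) = {0, 1}"
    "add (residue_ring 2) = (\<lambda>x y. (x + y) mod 2)" "monoid.mult (residue_ring 2) = (\<lambda>x y. (x * y) mod 2)"
    "one (residue_ring 2) = 1"
    by (auto simp: residue_ring_def)
  have "abelian_group (F2_space A)"
  proof (rule abelian_groupI)
    show "\<exists>y\<in>carrier (F2_space A). y \<oplus>\<^bsub>F2_space A\<^esub> x = \<zero>\<^bsub>F2_space A\<^esub>"
      if "x \<in> carrier (F2_space A)" for x
      using that exp2 by (auto simp: F2_space_def)
  qed (auto simp: F2_space_def A.m_ac)
  then have "module (residue_ring 2) (F2_space A)"
    by (intro moduleI F.is_cring) (auto simp: F_simps F2_space_def exp2 A.m_ac)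
  then show ?thesis
    by (intro vectorspace.intro F.is_field)
qed

text \<open>The sign characters form a dual system to the \<open>u i\<close>. If \<open>u i\<close>
  occurred in a linear relation, the i-th character would be -1 on the combination but 1 on the zero
  vector.\<close>

lemma le_rank2_if_characters:
  fixes \<chi> :: "nat \<Rightarrow> 'a \<Rightarrow> int"
  assumes A: "comm_group A" and fin: "finite (carrier A)"
    and exp2: "\<And>a. a \<in> carrier A \<Longrightarrow> a \<otimes>\<^bsub>A\<^esub> a = \<one>\<^bsub>A\<^esub>"
    and u: "\<And>i. i < m \<Longrightarrow> u i \<in> carrier A"
    and \<chi>_one: "\<And>i. i < m \<Longrightarrow> \<chi> i \<one>\<^bsub>A\<^esub> = 1"
    and \<chi>_mult: "\<And>i a b. i < m \<Longrightarrow> a \<in> carrier A \<Longrightarrow> b \<in> carrier A \<Longrightarrow> \<chi> i (a \<otimes>\<^bsub>A\<^esub> b) = \<chi> i a * \<chi> i b"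
    and \<chi>_u: "\<And>i j. i < m \<Longrightarrow> j < m \<Longrightarrow> \<chi> i (u j) = (if i = j then -1 else 1)"
  shows "m \<le> rank2 A"
proof -
  interpret A: comm_group A by fact
  let ?K = "residue_ring 2" and ?V = "F2_space A"
  interpret V: vectorspace ?K ?V by (rule vectorspace_F2_space[OF A exp2])
  have K_simps: "carrier ?K = {0, 1}" "zero ?K = 0" by (auto simp: residue_ring_def)
  have V_simps: "carrier ?V = carrier A" "zero ?V = \<one>\<^bsub>A\<^esub>" "add ?V = monoid.mult A"
    "smult ?V = (\<lambda>k a. a [^]\<^bsub>A\<^esub> k)"
    by (auto simp: F2_space_def)
  have \<chi>_finsum: "\<chi> i (finsum ?V f B) = (\<Prod>b\<in>B. \<chi> i (f b))"
    if "i < m" "finite B" "f \<in> B \<rightarrow> carrier A" for i f and B :: "'a set"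
    using that(2,3)
  proof (induction B rule: finite_induct)
    case empty
    then show ?case using \<chi>_one[OF that(1)] by (simp add: V_simps)
  next
    case (insert b B)
    have "finsum ?V f B \<in> carrier A" using insert V.finsum_closed[of f B] by (simp add: V_simps)
    then show ?case
      using insert \<chi>_mult[OF that(1)] by (simp add: V_simps)
  qed
  have inj: "inj_on u {..<m}"
  proof (rule inj_onI)
    fix i j assume ij: "i \<in> {..<m}" "j \<in> {..<m}" "u i = u j"
    then have "\<chi> i (u j) = -1" using \<chi>_u[of i i] by simp
    then show "i = j" using \<chi>_u[of i j] ij by (auto split: if_splits)
  qed
  have "\<not> V.lin_dep (u ` {..<m})"
  proof
    assume "V.lin_dep (u ` {..<m})"
    then obtain B a v where B: "finite B" "B \<subseteq> u ` {..<m}" "a \<in> B \<rightarrow> carrier ?K"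
      and zero: "V.lincomb a B = \<zero>\<^bsub>?V\<^esub>" and v: "v \<in> B" "a v \<noteq> \<zero>\<^bsub>?K\<^esub>"
      unfolding V.lin_dep_def by auto
    obtain i where i: "i < m" "v = u i" using v(1) B(2) by auto
    have val: "\<chi> i (a b \<odot>\<^bsub>?V\<^esub> b) = (if b = v then -1 else 1)" if b: "b \<in> B" for b
    proof -
      obtain j where j: "j < m" "b = u j" using b B(2) by auto
      have "a b = 0 \<or> a b = 1" using B(3) b by (auto simp: K_simps)
      moreover have "b = v \<longleftrightarrow> i = j" using inj i j by (auto simp: inj_on_def)
      moreover have "b = v \<Longrightarrow> a b \<noteq> 0" using v(2) by (auto simp: K_simps)
      ultimately show ?thesis
        using \<chi>_one[OF i(1)] \<chi>_u[OF i(1) j(1)] u[OF j(1)] j(2) by (auto simp: V_simps)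
    qed
    have "\<chi> i (V.lincomb a B) = (\<Prod>b\<in>B. \<chi> i (a b \<odot>\<^bsub>?V\<^esub> b))"
      unfolding V.lincomb_def
    proof (rule \<chi>_finsum[OF i(1) B(1)])
      show "(\<lambda>b. a b \<odot>\<^bsub>?V\<^esub> b) \<in> B \<rightarrow> carrier A"
        using B(2) u by (auto simp: V_simps)
    qed
    also have "\<dots> = (\<Prod>b\<in>B. if b = v then -1 else 1)" using val by (intro prod.cong) auto
    also have "\<dots> = -1" using B(1) v(1) by simp
    finally show False using zero \<chi>_one[OF i(1)] by (simp add: V_simps)
  qed
  \<comment> \<open>A finite group spans itself; finite dimension makes the size of an independent
    set a lower bound for \<open>V.dim\<close>.\<close>
  moreover have "V.fin_dim"
    unfolding V.fin_dim_def
  proof (intro exI conjI)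
    show "finite (carrier ?V)" using fin by (simp add: V_simps)
    show "V.gen_set (carrier ?V)"
      using V.span_is_subset2[of "carrier ?V"] V.in_own_span[of "carrier ?V"] by auto
  qed simp
  ultimately have "card (u ` {..<m}) \<le> V.dim"
    using u by (intro V.li_le_dim(2)) (auto simp: V_simps)
  then show ?thesis
    using inj by (simp add: rank2_def card_image)
qed

context fin_group begin

lemma core_trivial_units_simps [simp]:
  "monoid.mult (core_trivial_units G) = monoid.mult R" "one (core_trivial_units G) = one R"
  by (simp_all add: core_trivial_units_def units_of_def)

lemma
  shows comm_group_core_trivial_units: "comm_group (core_trivial_units G)"
    and core_trivial_units_square: "\<And>a. a \<in> carrier (core_trivial_units G) \<Longrightarrow> a \<otimes>\<^bsub>R\<^esub> a = \<one>\<^bsub>R\<^esub>"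
    and finite_core_trivial_units: "finite (carrier (core_trivial_units G))"
proof -
  let ?U = "carrier (core_trivial_units G)"
  have UR: "a \<in> carrier R" if "a \<in> ?U" for a
    using that by (simp add: carrier_core_trivial_units)
  have marks: "vmark a K = 1 \<or> vmark a K = -1" if "a \<in> ?U" "K \<subseteq> carrier G" for a K
    using that by (simp add: carrier_core_trivial_units)
  show square: "a \<otimes>\<^bsub>R\<^esub> a = \<one>\<^bsub>R\<^esub>" if "a \<in> ?U" for a
    using that burnside_square_eq_one marks UR by blast
  have closed: "a \<otimes>\<^bsub>R\<^esub> b \<in> ?U" if "a \<in> ?U" "b \<in> ?U" for a b
  proof -
    have ab: "a \<in> carrier R" "b \<in> carrier R" using that UR by auto
    have "vmark (a \<otimes>\<^bsub>R\<^esub> b) K = 1 \<or> vmark (a \<otimes>\<^bsub>R\<^esub> b) K = -1" if K: "K \<subseteq> carrier G" for K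
      using marks[OF \<open>a \<in> ?U\<close> K] marks[OF \<open>b \<in> ?U\<close> K] vmark_mult[OF ab K] by auto
    moreover have "vmark (a \<otimes>\<^bsub>R\<^esub> b) (insert g N) = 1" if "N \<lhd> G" "g \<in> carrier G" for g N
      using that \<open>a \<in> ?U\<close> \<open>b \<in> ?U\<close> ab normal_subset[of N]
      by (simp add: carrier_core_trivial_units vmark_mult)
    ultimately show ?thesis
      using burnside_mult_closed[OF ab] by (simp add: carrier_core_trivial_units)
  qed
  have one: "\<one>\<^bsub>R\<^esub> \<in> ?U"
    using normal_subset by (simp add: carrier_core_trivial_units)
  show "comm_group (core_trivial_units G)"
  proof (rule comm_groupI; simp)
    fix a b assume ab: "a \<in> ?U" "b \<in> ?U"
    show "a \<otimes>\<^bsub>R\<^esub> b \<in> ?U" by (rule closed[OF ab])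
    show "a \<otimes>\<^bsub>R\<^esub> b = b \<otimes>\<^bsub>R\<^esub> a"
      using UR[OF ab(1)] UR[OF ab(2)] by (intro burnside_ring_eqI) (simp_all add: burnside_mult_closed vmark_mult)
    show "\<one>\<^bsub>R\<^esub> \<otimes>\<^bsub>R\<^esub> a = a"
      using UR[OF ab(1)] by (intro burnside_ring_eqI) (simp_all add: burnside_mult_closed vmark_mult)
    show "\<exists>y\<in>?U. y \<otimes>\<^bsub>R\<^esub> a = \<one>\<^bsub>R\<^esub>" using square ab by blast
    fix c assume c: "c \<in> ?U"
    show "a \<otimes>\<^bsub>R\<^esub> b \<otimes>\<^bsub>R\<^esub> c = a \<otimes>\<^bsub>R\<^esub> (b \<otimes>\<^bsub>R\<^esub> c)"
      using UR[OF ab(1)] UR[OF ab(2)] UR[OF c]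
      by (intro burnside_ring_eqI) (simp_all add: burnside_mult_closed vmark_mult)
  qed (rule one)
  \<comment> \<open>Finiteness: an element is determined by its sign vector over the finitely many
    subsets of the group.\<close>
  let ?f = "\<lambda>a. \<lambda>K \<in> Pow (carrier G). vmark a K"
  have "?f ` ?U \<subseteq> Pow (carrier G) \<rightarrow>\<^sub>E {1, -1}"
  proof (intro image_subsetI PiE_I)
    fix a K assume "a \<in> ?U" "K \<in> Pow (carrier G)"
    then show "?f a K \<in> {1, -1}" using marks[of a K] by auto
  qed simp
  moreover have "finite (Pow (carrier G) \<rightarrow>\<^sub>E {1, -1 :: int})"
    using fin by (intro finite_PiE) auto
  moreover have "inj_on ?f ?U"
  proof (rule inj_onI)
    fix a b assume ab: "a \<in> ?U" "b \<in> ?U" "?f a = ?f b"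
    show "a = b"
    proof (rule burnside_ring_eqI)
      fix K assume "K \<subseteq> carrier G"
      then show "vmark a K = vmark b K" using fun_cong[OF ab(3), of K] by simp
    qed (use ab UR in auto)
  qed
  ultimately show "finite ?U"
    using finite_imageD finite_subset by metis
qed

text \<open>Taking the mark at a fixed subset is a sign character of the group of core-trivial
  units.\<close>

lemma le_rank2_core_trivial_units:
  assumes u: "\<And>i. i < m \<Longrightarrow> u i \<in> carrier (core_trivial_units G)"
    and L: "\<And>i. i < m \<Longrightarrow> L i \<subseteq> carrier G"
    and marks: "\<And>i j. i < m \<Longrightarrow> j < m \<Longrightarrow> vmark (u j) (L i) = (if i = j then -1 else 1)"
  shows "m \<le> rank2 (core_trivial_units G)"
proof (rule le_rank2_if_characters[where \<chi> = "\<lambda>i a. vmark a (L i)" and u = u])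
  fix i a b assume "i < m" "a \<in> carrier (core_trivial_units G)" "b \<in> carrier (core_trivial_units G)"
  then show "vmark (a \<otimes>\<^bsub>core_trivial_units G\<^esub> b) (L i) = vmark a (L i) * vmark b (L i)"
    using L by (simp add: carrier_core_trivial_units vmark_mult)
qed (use assms in \<open>simp_all add: comm_group_core_trivial_units core_trivial_units_square finite_core_trivial_units\<close>)

end

section \<open>The units of the Burnside ring of $S_4^m$\<close>

text \<open>The other three points are permuted without fixed points, hence by a 3-cycle. So no
  single permutation has both properties that single out S3: one common fixed point and an odd
  element.\<close>

lemma evenperm_if_unique_fixed_point:
  assumes p: "p permutes {1..4::nat}" and fix1: "card {x \<in> {1..4}. p x = x} = 1"
  shows "evenperm p"
proof -
  obtain a where a: "{x \<in> {1..4}. p x = x} = {a}"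
    using fix1 by (auto simp: card_1_singleton_iff)
  have "card ({1..4::nat} - {a}) = 3" using a by (subst card_Diff_singleton) auto
  then obtain b c d where D: "{1..4} - {a} = {b, c, d}" "b \<noteq> c" "b \<noteq> d" "c \<noteq> d"
    by (auto simp: card_3_iff)
  have pD: "p permutes {b, c, d}"
    unfolding D(1)[symmetric] by (rule permutes_superset[OF p]) (use a in auto)
  have moved: "p x \<noteq> x" if "x \<in> {b, c, d}" for x
    using that a unfolding D(1)[symmetric] by auto
  have inj: "p x = p y \<longleftrightarrow> x = y" for x y
    using permutes_inj[OF p] by (auto dest: injD)
  have img: "p b \<in> {b, c, d}" "p c \<in> {b, c, d}" "p d \<in> {b, c, d}"
    using permutes_in_image[OF pD] by auto
  have out: "p x = x" if "x \<notin> {b, c, d}" for x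
    using pD that by (auto simp: permutes_def)
  have "p b = c \<and> p c = d \<and> p d = b \<or> p b = d \<and> p c = b \<and> p d = c"
  proof -
    have "p b = c \<or> p b = d" "p c = b \<or> p c = d" "p d = b \<or> p d = c"
      using img moved by auto
    moreover have "p b \<noteq> p c" "p b \<noteq> p d" "p c \<noteq> p d"
      using inj D(2-4) by simp_all
    ultimately show ?thesis by metis
  qed
  \<comment> \<open>Both 3-cycles are products of two transpositions.\<close>
  then have "p = transpose b c \<circ> transpose c d \<or> p = transpose b d \<circ> transpose d c"
    using out D(2-4) by (auto simp: fun_eq_iff transpose_def)
  then show ?thesis
    using D(2-4) by (auto simp: evenperm_comp permutation_swap_id evenperm_swap)
qed

text \<open>The virtual set $1 - 2[S_4/S_3] + [S_4/C_3] + 2[S_4/C_2] - [S_4/1]$, where $S_4/S_3$ is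
  the natural set, $S_4/C_3$ is its product with the two-point set of signs, and $S_4/C_2$,
  $S_4/1$ are the ordered pairs and triples of distinct points.\<close>
lemma S3_detecting_polynomial:
  fixes L :: "(nat \<Rightarrow> nat) set"
  assumes L: "\<And>p. p \<in> L \<Longrightarrow> p permutes {1..4}"
    and x: "x = int (card {a \<in> {1..4}. \<forall>p \<in> L. p a = a})"
    and s: "s = (if \<forall>p \<in> L. evenperm p then 2 else 0)"
  shows "1 - 2 * x + x * s + 2 * (x * (x - 1)) - x * (x - 1) * (x - 2) =
    (if x = 1 \<and> \<not> (\<forall>p \<in> L. evenperm p) then -1 else 1)"
proof -
  define F where "F = {a \<in> {1..4::nat}. \<forall>p \<in> L. p a = a}"
  \<comment> \<open>The points moved by \<open>L\<close>. A permutation cannot move exactly one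
    point, and if only two points are moved then \<open>L\<close> contains their transposition,
    which is odd.\<close>
  define D where "D = {1..4} - F"
  have pD: "p permutes D" if "p \<in> L" for p
    by (rule permutes_superset[OF L[OF that]]) (use that in \<open>auto simp: D_def F_def\<close>)
  have F: "F \<subseteq> {1..4}" by (auto simp: F_def)
  have sum4: "card D + card F = 4"
    using F card_Diff_subset[of F "{1..4}"] card_mono[OF _ F] finite_subset[OF F] by (simp add: D_def)
  have moved: "\<exists>p \<in> L. p a \<noteq> a" if "a \<in> D" for a
    using that by (auto simp: D_def F_def)
  have D1: "card D \<noteq> 1"
  proof
    assume "card D = 1"
    then obtain a where "D = {a}" by (auto simp: card_1_singleton_iff)
    moreover from this obtain p where "p \<in> L" "p a \<noteq> a" using moved[of a] by auto
    ultimately show False using pD[of p] by simp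
  qed
  have D2: "s = 0" if two: "card D = 2"
  proof -
    obtain a b where ab: "D = {a, b}" "a \<noteq> b" using two unfolding card_2_iff by blast
    obtain p where p: "p \<in> L" "p a \<noteq> a" using moved[of a] ab by auto
    have "p = transpose a b"
      using pD[OF p(1)] p(2) ab by (auto simp: permutes_doubleton_iff)
    then have "\<not> evenperm p" using ab by (simp add: evenperm_swap)
    then show ?thesis using p(1) s by auto
  qed
  have D0: "s = 2" if "card D = 0"
  proof -
    have "D = {}" using that by (simp add: D_def)
    then have "\<forall>p \<in> L. evenperm p" using pD evenperm_id by (metis permutes_empty)
    then show ?thesis using s by simp
  qed
  have xF: "x = int (card F)" using x by (simp add: F_def)
  have "card D = 0 \<or> card D = 2 \<or> card D = 3 \<or> card D = 4"
    using sum4 D1 by arith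
  \<comment> \<open>The value x = 3 is excluded, and the polynomial takes the values 1, 1, s - 1 and
    1 in these cases. This explains the coefficients: 1 + x(s - 2) is right for x = 0, for x = 1 and
    for (4, 2), but off by -4 at (2, 0); 2x(x - 1) repairs that and adds 24 at x = 4, which the last
    term removes.\<close>
  then consider "x = 4" "s = 2" | "x = 2" "s = 0" | "x = 1" | "x = 0"
    using sum4 D0 D2 xF by fastforce
  then show ?thesis
    using s by cases auto
qed

section \<open>The groups $S_4^m$ and the inflated units\<close>

lemma S4_power_simps:
  "carrier (S4_power m) = (\<Pi>\<^sub>E i\<in>{..<m}. {p. p permutes {1..4}})"
  "monoid.mult (S4_power m) = (\<lambda>g h. \<lambda>i\<in>{..<m}. g i \<circ> h i)"
  "one (S4_power m) = (\<lambda>i\<in>{..<m}. id)"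
  by (simp_all add: S4_power_def sym_group_def)

lemma group_S4_power: "group (S4_power m)"
  unfolding S4_power_def by (intro product_group sym_group_is_group)

lemma finite_S4_power: "finite (carrier (S4_power m))"
  unfolding S4_power_simps by (intro finite_PiE finite_permutations) auto

lemma fin_group_S4_power: "fin_group (S4_power m)"
  by (intro fin_group.intro fin_group_axioms.intro group_S4_power finite_S4_power)

lemma permutes_S4_power: "g \<in> carrier (S4_power m) \<Longrightarrow> i < m \<Longrightarrow> g i permutes {1..4}"
  by (auto simp: S4_power_simps PiE_iff)

text \<open>The value is -1 exactly when the i-th projection of the subgroup generated by
  \<open>K\<close> is a point stabilizer S3: with one fixed point it is transitive on the other
  three, so it is C3 or S3, and an odd element excludes C3.\<close>

definition S3_mark :: "nat \<Rightarrow> (nat \<Rightarrow> nat \<Rightarrow> nat) set \<Rightarrow> int" where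
  "S3_mark i K =
    (if card {a \<in> {1..4}. \<forall>g \<in> K. g i a = a} = 1 \<and> \<not> (\<forall>g \<in> K. evenperm (g i)) then -1 else 1)"

lemma S3_unit_exists:
  assumes i: "i < m"
  shows "\<exists>u \<in> carrier (burnside_ring (S4_power m)). \<forall>K \<subseteq> carrier (S4_power m). vmark u K = S3_mark i K"
proof -
  interpret fin_group "S4_power m" by (rule fin_group_S4_power)
  \<comment> \<open>Inflation along the i-th projection: only the component \<open>g i\<close> acts,
    on the four points and on two signs. Booleans serve as the signs, swapped by odd
    permutations.\<close>
  let ?X = "gset_of {1..4::nat} (\<lambda>g :: nat \<Rightarrow> nat \<Rightarrow> nat. g i)"
  let ?S = "gset_of UNIV (\<lambda>(g :: nat \<Rightarrow> nat \<Rightarrow> nat) b. if evenperm (g i) then b else \<not> b)"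
  have perm: "g i permutes {1..4}" if "g \<in> carrier (S4_power m)" for g
    using permutes_S4_power[OF that i] .
  have permutation: "permutation (g i)" if "g \<in> carrier (S4_power m)" for g
    using perm[OF that] permutation_permutes by blast
  have X: "finite_gset (S4_power m) ?X"
    by (rule finite_gset_gset_of) (use i permutes_in_image[OF perm] in \<open>auto simp: S4_power_simps(2,3)\<close>)
  have S: "finite_gset (S4_power m) ?S"
    by (rule finite_gset_gset_of)
      (use i permutation in \<open>auto simp: S4_power_simps(2,3) evenperm_comp evenperm_id\<close>)
  define x where "x = mark ?X"
  define s where "s = mark ?S"
  have "ghost (\<lambda>K. 1 - 2 * x K + x K * s K + 2 * (x K * (x K - 1)) - x K * (x K - 1) * (x K - 2))"
    unfolding x_def s_def
    by (intro ghost_add ghost_diff ghost_mult ghost_const ghost_mark X S)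
  moreover have "1 - 2 * x K + x K * s K + 2 * (x K * (x K - 1)) - x K * (x K - 1) * (x K - 2) = S3_mark i K"
    if K: "K \<subseteq> carrier (S4_power m)" for K
  proof -
    let ?L = "(\<lambda>g. g i) ` K"
    have x: "x K = int (card {a \<in> {1..4}. \<forall>p \<in> ?L. p a = a})"
      by (simp add: x_def mark_def fixed_points_gset_of)
    have "fixed_points ?S K = (if \<forall>p \<in> ?L. evenperm p then UNIV else {})"
      by (auto simp: fixed_points_gset_of)
    then have s: "s K = (if \<forall>p \<in> ?L. evenperm p then 2 else 0)"
      by (simp add: s_def mark_def)
    have "1 - 2 * x K + x K * s K + 2 * (x K * (x K - 1)) - x K * (x K - 1) * (x K - 2) =
        (if x K = 1 \<and> \<not> (\<forall>p \<in> ?L. evenperm p) then -1 else 1)"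
      by (rule S3_detecting_polynomial[OF _ x s]) (use K perm in blast)
    also have "\<dots> = S3_mark i K"
      unfolding S3_mark_def x by simp
    finally show ?thesis .
  qed
  ultimately show ?thesis by (simp add: ghost_def)
qed

text \<open>The points of the i-th factor fixed by a normal N are invariant under all of S4, so a
  single fixed point forces N to act trivially there. Then g alone has exactly one fixed point and
  is a 3-cycle, hence even.\<close>

lemma S3_mark_normal_cyclic:
  assumes i: "i < m" and N: "N \<lhd> S4_power m" and g: "g \<in> carrier (S4_power m)"
  shows "S3_mark i (insert g N) = 1"
proof -
  interpret normal N "S4_power m" by (rule N)
  have "\<forall>k \<in> insert g N. evenperm (k i)" if one: "card {a \<in> {1..4}. \<forall>k \<in> insert g N. k i a = a} = 1"
  proof -
    obtain a where a: "{a \<in> {1..4}. \<forall>k \<in> insert g N. k i a = a} = {a}"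
      using one by (auto simp: card_1_singleton_iff)
    have fixN: "n i b = b" if n: "n \<in> N" and b: "b \<in> {1..4}" for n b
    proof -
      define h where "h = (\<lambda>j\<in>{..<m}. if j = i then transpose a b else id)"
      have h: "h \<in> carrier (S4_power m)"
        unfolding h_def S4_power_simps restrict_PiE_iff
        using permutes_swap_id[of a "{1..4}" b] a b by (auto simp: permutes_id)
      \<comment> \<open>Normality as equality of left and right cosets. Evaluating n h = h n' at a,
        which n' fixes and h sends to b, shows that n fixes b.\<close>
      have "n \<otimes>\<^bsub>S4_power m\<^esub> h \<in> h <#\<^bsub>S4_power m\<^esub> N"
        using n coset_eq h by (auto simp: r_coset_def)
      then obtain n' where n': "n' \<in> N" "n \<otimes>\<^bsub>S4_power m\<^esub> h = h \<otimes>\<^bsub>S4_power m\<^esub> n'"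
        by (auto simp: l_coset_def)
      have "n i (h i a) = h i (n' i a)"
        using fun_cong[OF n'(2), of i] i by (simp add: S4_power_simps fun_eq_iff)
      moreover have "n' i a = a" using a n'(1) by auto
      ultimately show ?thesis using i by (simp add: h_def)
    qed
    have "n i = id" if n: "n \<in> N" for n
    proof
      fix b
      show "n i b = id b"
        using fixN[OF n, of b] permutes_S4_power[OF mem_carrier[OF n] i] by (cases "b \<in> {1..4}") (auto simp: permutes_def)
    qed
    moreover have "evenperm (g i)"
    proof (rule evenperm_if_unique_fixed_point[OF permutes_S4_power[OF g i]])
      have "{b \<in> {1..4}. g i b = b} = {b \<in> {1..4}. \<forall>k \<in> insert g N. k i b = b}"
        using fixN by auto
      then show "card {b \<in> {1..4}. g i b = b} = 1" using one by simp
    qed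
    ultimately show ?thesis by (simp add: evenperm_id)
  qed
  then show ?thesis by (auto simp: S3_mark_def)
qed

text \<open>The $i$-th copy of $S_3$ is generated by two transpositions, and marks only need generators.\<close>
lemma rank2_core_trivial_units_S4_power: "m \<le> rank2 (core_trivial_units (S4_power m))"
proof -
  interpret fin_group "S4_power m" by (rule fin_group_S4_power)
  define u where "u i = (SOME u. u \<in> carrier (burnside_ring (S4_power m)) \<and>
    (\<forall>K \<subseteq> carrier (S4_power m). vmark u K = S3_mark i K))" for i
  have u: "u i \<in> carrier (burnside_ring (S4_power m))"
    and vmark_u: "\<And>K. K \<subseteq> carrier (S4_power m) \<Longrightarrow> vmark (u i) K = S3_mark i K" if i: "i < m" for i
    using someI_ex[of "\<lambda>u. u \<in> carrier (burnside_ring (S4_power m)) \<and>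
      (\<forall>K \<subseteq> carrier (S4_power m). vmark u K = S3_mark i K)"] S3_unit_exists[OF i]
    unfolding u_def[of i] by auto
  define t where "t i p = (\<lambda>j\<in>{..<m}. if j = i then p else id :: nat \<Rightarrow> nat)" for i p
  define L where "L i = t i ` {transpose 1 2, transpose 2 (3::nat)}" for i
  have L: "L i \<subseteq> carrier (S4_power m)" for i
    by (auto simp: L_def t_def S4_power_simps permutes_id intro!: permutes_swap_id)
  show ?thesis
  proof (rule le_rank2_core_trivial_units[of m u L])
    fix i assume i: "i < m"
    have "S3_mark i K = 1 \<or> S3_mark i K = -1" for K :: "(nat \<Rightarrow> nat \<Rightarrow> nat) set" by (simp add: S3_mark_def)
    then show "u i \<in> carrier (core_trivial_units (S4_power m))"
      using u[OF i] vmark_u[OF i] normal_subset S3_mark_normal_cyclic[OF i]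
      by (simp add: carrier_core_trivial_units)
    fix j assume j: "j < m"
    have set4: "{1..4::nat} = {1, 2, 3, 4}" by auto
    have "S3_mark j (L i) = (if i = j then -1 else 1)"
    proof (cases "i = j")
      case True
      have "{a \<in> {1..4}. \<forall>g \<in> L i. g j a = a} = {4}"
        using True i by (auto simp: L_def t_def set4 transpose_def)
      moreover have "\<not> (\<forall>g \<in> L i. evenperm (g j))"
        using True i by (auto simp: L_def t_def evenperm_swap)
      ultimately show ?thesis using True by (simp add: S3_mark_def)
    next
      case False
      \<comment> \<open>The generators of the i-th S3 are trivial in every other component, so no
        odd permutation appears there.\<close>
      then have "\<forall>g \<in> L i. evenperm (g j)"
        using j by (auto simp: L_def t_def evenperm_id)
      then show ?thesis using False by (simp add: S3_mark_def)
    qed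
    then show "vmark (u j) (L i) = (if i = j then -1 else 1)"
      using vmark_u[OF j L] by simp
  qed (rule L)
qed

theorem mainTheorem16:
  shows "(\<forall>m::nat. m \<ge> 1 \<longrightarrow> rank2 (core_trivial_units (S4_power m)) \<ge> m) \<and>
    \<not> bdd_above {rank2 (core_trivial_units G) | G :: (nat \<Rightarrow> nat \<Rightarrow> nat) monoid.
                    group G \<and> finite (carrier G)}"
proof
  show "\<forall>m::nat. m \<ge> 1 \<longrightarrow> rank2 (core_trivial_units (S4_power m)) \<ge> m"
    using rank2_core_trivial_units_S4_power by blast
  show "\<not> bdd_above {rank2 (core_trivial_units G) | G :: (nat \<Rightarrow> nat \<Rightarrow> nat) monoid.
                    group G \<and> finite (carrier G)}"
  proof
    assume "bdd_above {rank2 (core_trivial_units G) | G :: (nat \<Rightarrow> nat \<Rightarrow> nat) monoid.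
                    group G \<and> finite (carrier G)}"
    then obtain B where B: "rank2 (core_trivial_units G) \<le> B"
      if "group G" "finite (carrier G)" for G :: "(nat \<Rightarrow> nat \<Rightarrow> nat) monoid"
      unfolding bdd_above_def by blast
    have "rank2 (core_trivial_units (S4_power (Suc B))) \<le> B"
      by (rule B[OF group_S4_power finite_S4_power])
    then show False
      using rank2_core_trivial_units_S4_power[of "Suc B"] by simp
  qed
qed

end
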